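(* Let $d\geq 2$ and $\lambda\in(0,1)$. There is a constant $C>0$, depending only on $\lambda$ and $d$, such that the following holds. Let $K$ be a continuum (compact connected set) in $\mathbb{R}^d$ and suppose $K=W\cup E$ with $\mathcal{H}^1(W)>0$ and $\mathcal{H}^1(E)<\infty$. If $\epsilon,\kappa\in(0,1)$ are such that for every $z\in W$ the set $K$ is not $\epsilon$-porous at $z$ at scales of density $\kappa$ (with respect to $\lambda$), then $$\dim_H(K)\geq 1+\kappa\left(d-1-\frac{C}{|\log\epsilon|}\right).$$
   Context: $\mathcal{H}^1$ is the $1$-dimensional Hausdorff measure, $\dim_H$ the Hausdorff dimension, $B(x,r)$ the ball of center $x$ and radius $r$ in $\mathbb{R}^d$. A set $K\subset\mathbb{R}^d$ is $\epsilon$-porous at $x$ at scale $r>0$ if there is $z\in B(x,r)$ such that $B(z,\epsilon r)\subset B(x,r)\setminus K$. The set $K$ is not $\epsilon$-porous at $z\in K$ at scales of density $\kappa>0$ (with respect to $\lambda\in(0,1)$) if $$\liminf_{m\to\infty}\frac1m\,\#\{n\in\mathbb{Z}\cap(0,m):\ K \text{ is not } \epsilon\text{-porous at scale } \lambda^n \text{ at } z\}\geq\kappa .$$ *)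

theory Defs
  imports "HOL-Analysis.Analysis"
begin

(* The convention 0 ^ 0 = 1 applies to nonempty sets, whereas 0 powr 0 = 0; hence the case s = 0. *)
definition diam_pow :: "real \<Rightarrow> 'a::metric_space set \<Rightarrow> ennreal" where
  "diam_pow s U =
     (if U = {} then 0 else if s = 0 then 1 else ennreal (diameter U powr s))"

(* Boundedness is required because the library's diameter is not meaningful on unbounded sets.
   Finite covers are included, since U i may be empty. *)
definition hausdorff_premeasure :: "real \<Rightarrow> real \<Rightarrow> 'a::metric_space set \<Rightarrow> ennreal" where
  "hausdorff_premeasure s \<delta> A =
     (INF U \<in> {U :: nat \<Rightarrow> 'a set. A \<subseteq> (\<Union>i. U i) \<and> (\<forall>i. bounded (U i) \<and> diameter (U i) \<le> \<delta>)}.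
        \<Sum>i. diam_pow s (U i))"

(* An outer measure, defined on all sets, without a normalising constant
   (for s = 1 the usual constant is 1). *)
definition hausdorff_measure :: "real \<Rightarrow> 'a::metric_space set \<Rightarrow> ennreal" where
  "hausdorff_measure s A = (SUP \<delta> \<in> {0<..}. hausdorff_premeasure s \<delta> A)"

definition hausdorff_dim :: "'a::metric_space set \<Rightarrow> ereal" where
  "hausdorff_dim A = (INF s \<in> {s. 0 \<le> s \<and> hausdorff_measure s A = 0}. ereal s)"

definition porous_at :: "real \<Rightarrow> 'a::metric_space set \<Rightarrow> 'a \<Rightarrow> real \<Rightarrow> bool" where
  "porous_at \<epsilon> K x r \<longleftrightarrow> (\<exists>z \<in> ball x r. ball z (\<epsilon> * r) \<subseteq> ball x r - K)"

definition not_porous_with_density ::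
    "real \<Rightarrow> real \<Rightarrow> real \<Rightarrow> 'a::metric_space set \<Rightarrow> 'a \<Rightarrow> bool" where
  "not_porous_with_density lam \<epsilon> \<kappa> K z \<longleftrightarrow>
     ereal \<kappa> \<le> liminf (\<lambda>m::nat.
       ereal (real (card {n::nat. 0 < n \<and> n < m \<and> \<not> porous_at \<epsilon> K z (lam ^ n)}) / real m))"

end

theory Submission
  imports Defs
begin

text \<open>
  Work with dyadic cubes. A cube is central if K has a point near its centre; as K is connected and
  leaves the cube, every cover of the part of K inside has total side length at least an eighth of the
  side. Where K is not porous, a cube Q has all its 2^(dJ) descendants of relative size 2^(-J) \<approx> \<epsilon> central,
  so K has length about g = 2^((d-1)J) relative to Q. Give a cube e the weight (side of e) / g^k, where k
  counts the disjoint blocks of J levels above e that begin with such a good cube. Between good cubes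
  connectedness loses only the constant factor, and this factor is absorbed into g; hence, from the
  bottom up, the total weight of any finite cover of K dominates the total side length of some other
  cover of K. Near a point of W at least \<kappa>n of the first n scales are good, each block contains at most
  J/\<theta> + 1 of them, where lam = 2^(-\<theta>), and so the weight of a small cube is at most (side)^s up to a
  constant.

  Suppose that K is s-null and has infinite length. Then W has a cover of tiny weight and E one of bounded
  weight, which contradicts the infinite length of K. If K has finite length, then replacing the
  contents of maximal good cubes by the cubes themselves would shorten nearly optimal covers, unless
  W is null. For \<epsilon> not small, the asserted bound is at most 1.
\<close>

subsection \<open>Dyadic cubes\<close>

text \<open>A bad cube gives no lower bound by itself, since \<open>K\<close> may barely meet it; so
  no estimate of single cubes can be passed upwards through bad scales. What the induction passes
  upwards is a cover. At a bad cube the covers of the children are united at no cost. Only at a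
  counted good cube is a cover turned into a lower bound, by connectedness, and then replaced by the
  cube itself. A factor 8 lost at every level would be fatal; one factor 8 per block of J levels is
  not. With n the dimension, log2 g = (n-1)J - 3, and a block uses up J/\<theta> + 1 good scales,
  each worth \<theta> dyadic levels. The exponent gained is thus \<kappa>((n-1)J - 3)/(J + \<theta>)
  = \<kappa>(n-1 - (3 + (n-1)\<theta>)/(J + \<theta>)), and J comparable to |log \<epsilon>| gives
  the error term C/|log \<epsilon>|. The level from which weights decay depends on the point of W,
  so W is covered by balls whose radii are bounded by a function of the centre; compactness of K
  then makes the cover finite.\<close>

type_synonym 'n cube = "nat \<times> (int, 'n) vec"

definition cell :: "nat \<Rightarrow> real ^ 'n::finite \<Rightarrow> 'n cube" where
  "cell p x = (p, \<chi> i. \<lfloor>2 ^ p * x $ i\<rfloor>)"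

text \<open>\<open>div\<close> rounds towards minus infinity, so negative indices are handled
  correctly. For \<open>j > fst c\<close> the exponent truncates to 0 and the value is meaningless;
  hence the inequality in \<open>below\<close>.\<close>

definition anc :: "nat \<Rightarrow> 'n::finite cube \<Rightarrow> 'n cube" where
  "anc j c = (j, \<chi> i. snd c $ i div 2 ^ (fst c - j))"

text \<open>The cubes are half-open: those of one level partition the space, so two cubes that meet
  are nested (\<open>below_if_common\<close>).\<close>

definition cube_set :: "'n::finite cube \<Rightarrow> (real ^ 'n) set" where
  "cube_set c = {x. cell (fst c) x = c}"

text \<open>The larger cube comes first: in \<open>below c e\<close> the descendant is
  \<open>e\<close>.\<close>

definition below :: "'n::finite cube \<Rightarrow> 'n cube \<Rightarrow> bool" where
  "below c e \<longleftrightarrow> fst c \<le> fst e \<and> anc (fst c) e = c"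

definition centre :: "'n::finite cube \<Rightarrow> real ^ 'n" where
  "centre c = (\<chi> i. (real_of_int (snd c $ i) + 1 / 2) / 2 ^ fst c)"

lemma fst_cell [simp]: "fst (cell p x) = p"
  by (simp add: cell_def)

lemma fst_anc [simp]: "fst (anc j c) = j"
  by (simp add: anc_def)

lemma mem_cube_set_cell [simp]: "x \<in> cube_set (cell p x)"
  by (simp add: cube_set_def)

lemma mem_cube_set_iff:
  "x \<in> cube_set c \<longleftrightarrow>
     (\<forall>i. real_of_int (snd c $ i) / 2 ^ fst c \<le> x $ i \<and> x $ i < (real_of_int (snd c $ i) + 1) / 2 ^ fst c)"
proof -
  have "x \<in> cube_set c \<longleftrightarrow> (\<forall>i. \<lfloor>2 ^ fst c * x $ i\<rfloor> = snd c $ i)"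
    by (cases c) (auto simp: cube_set_def cell_def vec_eq_iff)
  also have "\<dots> \<longleftrightarrow> (\<forall>i. real_of_int (snd c $ i) / 2 ^ fst c \<le> x $ i \<and> x $ i < (real_of_int (snd c $ i) + 1) / 2 ^ fst c)"
    by (simp add: floor_eq_iff field_simps)
  finally show ?thesis .
qed

lemma floor_pow2_div:
  fixes t :: real
  assumes "j \<le> p"
  shows "\<lfloor>2 ^ p * t\<rfloor> div 2 ^ (p - j) = \<lfloor>2 ^ j * t\<rfloor>"
proof -
  have "(2::real) ^ p = 2 ^ j * 2 ^ (p - j)"
    using assms by (simp flip: power_add)
  then have "\<lfloor>2 ^ j * t\<rfloor> = \<lfloor>2 ^ p * t / real_of_int (2 ^ (p - j))\<rfloor>"
    by simp
  also have "\<dots> = \<lfloor>2 ^ p * t\<rfloor> div 2 ^ (p - j)"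
    by (rule floor_divide_real_eq_div) simp
  finally show ?thesis by simp
qed

lemma anc_cell: "j \<le> p \<Longrightarrow> anc j (cell p x) = cell j x"
  by (simp add: anc_def cell_def floor_pow2_div)

lemma anc_self [simp]: "anc (fst c) c = c"
  by (cases c) (simp add: anc_def vec_eq_iff)

lemma anc_anc: "i \<le> j \<Longrightarrow> j \<le> fst c \<Longrightarrow> anc i (anc j c) = anc i c"
proof -
  assume "i \<le> j" "j \<le> fst c"
  then have "(2::int) ^ (fst c - i) = 2 ^ (fst c - j) * 2 ^ (j - i)"
    by (simp flip: power_add)
  then show ?thesis
    by (simp add: anc_def zdiv_zmult2_eq)
qed

lemma below_refl [simp]: "below c c"
  by (simp add: below_def)

lemma below_level: "below c e \<Longrightarrow> fst c \<le> fst e"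
  by (simp add: below_def)

lemma below_trans:
  assumes "below c d" "below d e" shows "below c e"
proof -
  have "anc (fst d) e = d" and l: "fst c \<le> fst d" "fst d \<le> fst e"
    and c: "anc (fst c) d = c"
    using assms unfolding below_def by blast+
  then have "anc (fst c) e = anc (fst c) d"
    using anc_anc[OF l] by simp
  with l c show ?thesis unfolding below_def by simp
qed

lemma below_linear:
  assumes "below c e" "below d e" "fst c \<le> fst d" shows "below c d"
proof -
  have "anc (fst d) e = d" and l: "fst c \<le> fst d" "fst d \<le> fst e"
    and c: "anc (fst c) e = c"
    using assms unfolding below_def by blast+
  then have "anc (fst c) e = anc (fst c) d"
    using anc_anc[OF l] by simp
  with l c show ?thesis unfolding below_def by simp
qed

lemma below_anc: "j \<le> fst e \<Longrightarrow> below (anc j e) e"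
  by (simp add: below_def)

lemma below_eq: "below c e \<Longrightarrow> fst e = fst c \<Longrightarrow> e = c"
  unfolding below_def by (metis anc_self)

lemma below_antisym: "below c e \<Longrightarrow> below e c \<Longrightarrow> e = c"
  using below_eq below_level by (metis le_antisym)

lemma cube_set_mono:
  assumes "below c e" shows "cube_set e \<subseteq> cube_set c"
proof
  fix x assume "x \<in> cube_set e"
  then have "cell (fst e) x = e" by (simp add: cube_set_def)
  then have "cell (fst c) x = c"
    using assms anc_cell[of "fst c" "fst e" x] by (simp add: below_def)
  then show "x \<in> cube_set c" by (simp add: cube_set_def)
qed

lemma below_if_common:
  assumes "x \<in> cube_set c" "x \<in> cube_set e" "fst c \<le> fst e" shows "below c e"
proof -
  have "cell (fst e) x = e" "cell (fst c) x = c" using assms by (simp_all add: cube_set_def)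
  then show ?thesis using assms anc_cell[of "fst c" "fst e" x] by (simp add: below_def)
qed

lemma centre_in_cube: "centre c \<in> cube_set c"
  by (auto simp: mem_cube_set_iff centre_def field_simps)

lemma cube_coord_diff:
  assumes "x \<in> cube_set c" "y \<in> cube_set c"
  shows "\<bar>x $ i - y $ i\<bar> \<le> (1 / 2) ^ fst c"
proof -
  have "real_of_int (snd c $ i) / 2 ^ fst c \<le> x $ i \<and> x $ i < (real_of_int (snd c $ i) + 1) / 2 ^ fst c"
    "real_of_int (snd c $ i) / 2 ^ fst c \<le> y $ i \<and> y $ i < (real_of_int (snd c $ i) + 1) / 2 ^ fst c"
    using assms mem_cube_set_iff by blast+
  then show ?thesis
    by (simp add: power_one_over add_divide_distrib abs_le_iff)
qed

section \<open>Counting subcubes and summing over the dyadic tree\<close>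

lemma card_vec_family:
  fixes A :: "'n::finite \<Rightarrow> 'a set"
  assumes "\<And>i. finite (A i)"
  shows "finite {u :: 'a ^ 'n. \<forall>i. u $ i \<in> A i}"
    and "card {u :: 'a ^ 'n. \<forall>i. u $ i \<in> A i} = (\<Prod>i\<in>UNIV. card (A i))"
proof -
  have b: "bij_betw vec_lambda (Pi\<^sub>E UNIV A) {u. \<forall>i. u $ i \<in> A i}"
    by (rule bij_betw_byWitness[where f' = "\<lambda>u i. u $ i"]) (auto simp: PiE_def Pi_def)
  have "finite (Pi\<^sub>E UNIV A)"
    using assms by (simp add: finite_PiE)
  with b show "finite {u :: 'a ^ 'n. \<forall>i. u $ i \<in> A i}"
    using bij_betw_finite by blast
  show "card {u :: 'a ^ 'n. \<forall>i. u $ i \<in> A i} = (\<Prod>i\<in>UNIV. card (A i))"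
    using bij_betw_same_card[OF b] by (simp add: card_PiE)
qed

definition children :: "'n::finite cube \<Rightarrow> 'n cube set" where
  "children c = {e. below c e \<and> fst e = Suc (fst c)}"

lemma children_eq:
  "children c = Pair (Suc (fst c)) ` {u. \<forall>i. u $ i \<in> {2 * snd c $ i, 2 * snd c $ i + 1}}"
proof -
  have "u div 2 = v \<longleftrightarrow> u \<in> {2 * v, 2 * v + 1}" for u v :: int
    by auto
  then show ?thesis
    by (cases c) (force simp: children_def below_def anc_def vec_eq_iff)
qed

lemma finite_children: "finite (children c)"
  and card_children: "card (children (c :: 'n::finite cube)) = 2 ^ CARD('n)"
  unfolding children_eq
  using card_vec_family[of "\<lambda>i. {2 * snd c $ i, 2 * snd c $ i + 1}"]
  by (auto simp: card_image inj_on_def numeral_2_eq_2 intro!: finite_imageI)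

lemma below_strict_child:
  assumes "below c e" "e \<noteq> c"
  shows "anc (Suc (fst c)) e \<in> children c" "below (anc (Suc (fst c)) e) e"
proof -
  have l: "Suc (fst c) \<le> fst e"
    using assms below_eq below_level by (metis le_antisym not_less_eq_eq)
  then show "below (anc (Suc (fst c)) e) e"
    by (rule below_anc)
  then show "anc (Suc (fst c)) e \<in> children c"
    using below_linear[OF assms(1)] by (simp add: children_def)
qed

text \<open>With \<open>c\<close> in \<open>I\<close> its own term would be lost on the right, as
  \<open>c\<close> lies below none of its children.\<close>

lemma sum_below_children:
  fixes u :: "'n::finite cube \<Rightarrow> real"
  assumes "finite I" "c \<notin> I"
  shows "(\<Sum>e\<in>{e\<in>I. below c e}. u e) = (\<Sum>d\<in>children c. \<Sum>e\<in>{e\<in>I. below d e}. u e)"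
proof -
  have "{e\<in>I. below c e} = (\<Union>d\<in>children c. {e\<in>I. below d e})"
    using assms(2) below_strict_child below_trans unfolding children_def by fast
  moreover have "{e\<in>I. below d e} \<inter> {e\<in>I. below d' e} = {}"
    if "d \<in> children c" "d' \<in> children c" "d \<noteq> d'" for d d'
    using that unfolding children_def below_def by auto
  ultimately show ?thesis
    using assms(1) by (simp add: sum.UNION_disjoint finite_children)
qed

text \<open>A member of I met on the way down must carry the mass of all the cubes t levels below c that it replaces.\<close>
lemma sum_below_descendants:
  fixes u :: "'n::finite cube \<Rightarrow> real"
  assumes fin: "finite I" and nn: "\<And>e. e \<in> I \<Longrightarrow> 0 \<le> u e"
    and deep: "\<And>d. below c d \<Longrightarrow> fst d = fst c + t \<Longrightarrow>
        (\<And>e. e \<in> I \<Longrightarrow> below c e \<Longrightarrow> below e d \<Longrightarrow> e = d) \<Longrightarrow>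
        a \<le> (\<Sum>e\<in>{e\<in>I. below d e}. u e)"
    and early: "\<And>e. e \<in> I \<Longrightarrow> below c e \<Longrightarrow> fst e < fst c + t \<Longrightarrow>
        2 ^ (CARD('n) * (fst c + t - fst e)) * a \<le> u e"
  shows "2 ^ (CARD('n) * t) * a \<le> (\<Sum>e\<in>{e\<in>I. below c e}. u e)"
  using deep early
proof (induction t arbitrary: c)
  case 0
  have "a \<le> (\<Sum>e\<in>{e\<in>I. below c e}. u e)"
    using 0(1)[of c] below_antisym[of c] by fastforce
  then show ?case by simp
next
  case (Suc t)
  show ?case
  proof (cases "c \<in> I")
    case True
    have "2 ^ (CARD('n) * Suc t) * a \<le> u c"
      using Suc.prems(2)[of c] True by simp
    also have "\<dots> \<le> (\<Sum>e\<in>{e\<in>I. below c e}. u e)"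
      using fin nn True by (intro member_le_sum) auto
    finally show ?thesis .
  next
    case False
    have "2 ^ (CARD('n) * t) * a \<le> (\<Sum>e\<in>{e\<in>I. below d e}. u e)" if d: "d \<in> children c" for d
    proof (rule Suc.IH)
      have dl: "fst d = Suc (fst c)" "below c d" using d by (auto simp: children_def)
      fix d' assume d': "below d d'" "fst d' = fst d + t"
        "\<And>e. e \<in> I \<Longrightarrow> below d e \<Longrightarrow> below e d' \<Longrightarrow> e = d'"
      show "a \<le> (\<Sum>e\<in>{e\<in>I. below d' e}. u e)"
      proof (rule Suc.prems(1))
        show "below c d'" using dl d' below_trans by blast
        show "fst d' = fst c + Suc t" using dl d' by simp
        fix e assume e: "e \<in> I" "below c e" "below e d'"
        then have "e \<noteq> c" using False by auto
        then have "Suc (fst c) \<le> fst e"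
          using e below_eq below_level by (metis le_antisym not_less_eq_eq)
        then have "below d e"
          using below_linear[OF d'(1) e(3)] dl by simp
        then show "e = d'" using d'(3) e by blast
      qed
    next
      fix e assume e: "e \<in> I" "below d e" "fst e < fst d + t"
      have dl: "fst d = Suc (fst c)" "below c d" using d by (auto simp: children_def)
      then show "2 ^ (CARD('n) * (fst d + t - fst e)) * a \<le> u e"
        using Suc.prems(2)[of e] e below_trans[OF dl(2) e(2)] by simp
    qed
    then have "(\<Sum>d\<in>children c. 2 ^ (CARD('n) * t) * a) \<le> (\<Sum>d\<in>children c. \<Sum>e\<in>{e\<in>I. below d e}. u e)"
      by (rule sum_mono)
    then show ?thesis
      using sum_below_children[OF fin False, of u] by (simp add: card_children power_add)
  qed
qed

text \<open>The sup-distance to the centre of Q maps K onto an interval of a quarter of the side length,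
  and each covering cube onto a set of diameter at most its side length.\<close>
lemma central_cube_cover_sum:
  fixes K :: "(real ^ 'n::finite) set"
  assumes con: "connected K" and esc: "\<not> K \<subseteq> cube_set Q"
    and y: "y \<in> K" "\<And>i. \<bar>y $ i - centre Q $ i\<bar> \<le> (1 / 2) ^ fst Q / 4"
    and T: "finite T" "K \<inter> cube_set Q \<subseteq> (\<Union>t\<in>T. cube_set t)"
  shows "(1 / 2) ^ fst Q / 8 \<le> (\<Sum>t\<in>T. (1 / 2 :: real) ^ fst t)"
proof -
  define l :: real where "l = (1 / 2) ^ fst Q"
  have l: "l > 0" by (simp add: l_def)
  define f where "f x = infnorm (x - centre Q)" for x
  have cf: "continuous_on K f"
    unfolding f_def by (intro continuous_on_infnorm continuous_intros)
  have infle: "infnorm v \<le> b" if "\<And>i. \<bar>v $ i\<bar> \<le> b" for v :: "real ^ 'n" and b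
    unfolding infnorm_cart using that by (intro cSup_least) auto
  have leinf: "\<bar>v $ i\<bar> \<le> infnorm v" for v :: "real ^ 'n" and i
    by (rule component_le_infnorm_cart)
  \<comment> \<open>The inequality is strict because the cube is half-open.\<close>
  have inQ: "x \<in> cube_set Q" if "\<And>i. \<bar>x $ i - centre Q $ i\<bar> < l / 2" for x
    unfolding mem_cube_set_iff
  proof
    fix i
    have "centre Q $ i = (real_of_int (snd Q $ i) + 1 / 2) * l"
      by (simp add: centre_def l_def power_one_over)
    then have "\<bar>x $ i - (real_of_int (snd Q $ i) + 1 / 2) * l\<bar> < l / 2"
      using that[of i] by simp
    moreover have "real_of_int (snd Q $ i) / 2 ^ fst Q = real_of_int (snd Q $ i) * l"
      "(real_of_int (snd Q $ i) + 1) / 2 ^ fst Q = real_of_int (snd Q $ i) * l + l"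
      by (simp_all add: l_def power_one_over add_divide_distrib)
    ultimately show "real_of_int (snd Q $ i) / 2 ^ fst Q \<le> x $ i \<and>
        x $ i < (real_of_int (snd Q $ i) + 1) / 2 ^ fst Q"
      unfolding abs_less_iff by (simp add: algebra_simps)
  qed
  have fy: "f y \<le> l / 4"
    unfolding f_def using y(2) by (intro infle) (simp add: l_def)
  obtain y' where y': "y' \<in> K" "y' \<notin> cube_set Q" using esc by blast
  then obtain i where "l / 2 \<le> \<bar>y' $ i - centre Q $ i\<bar>"
    using inQ by (meson not_less)
  also have "\<dots> \<le> f y'" unfolding f_def using leinf[of "y' - centre Q" i] by simp
  finally have fy': "l / 2 \<le> f y'" .
  \<comment> \<open>Points of \<open>K\<close> with \<open>f\<close> below l/2 lie in
    \<open>Q\<close> and so are covered by \<open>T\<close>. The interval of \<open>t\<close> is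
    centred at \<open>f (centre t)\<close> and is twice as long as the side of \<open>t\<close>;
    this turns l/4 into the l/8 of the claim.\<close>
  have cov: "{l / 4..<l / 2} \<subseteq> (\<Union>t\<in>T. cbox (f (centre t) - (1 / 2) ^ fst t) (f (centre t) + (1 / 2) ^ fst t))"
  proof
    fix s assume s: "s \<in> {l / 4..<l / 2}"
    have "connected (f ` K)" using cf con by (rule connected_continuous_image)
    then have "s \<in> f ` K"
      using s fy fy' y y' connectedD_interval[of "f ` K" "f y" "f y'" s] by auto
    then obtain x where x: "x \<in> K" "f x = s" by auto
    have "\<bar>x $ i - centre Q $ i\<bar> < l / 2" for i
      using leinf[of "x - centre Q" i] x s unfolding f_def by simp
    then have "x \<in> cube_set Q" by (rule inQ)
    then obtain t where t: "t \<in> T" "x \<in> cube_set t" using T x by blast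
    have "\<bar>f x - f (centre t)\<bar> \<le> infnorm (x - centre t)"
      unfolding f_def using absdiff_infnorm[of "x - centre Q" "centre t - centre Q"] by simp
    also have "\<dots> \<le> (1 / 2) ^ fst t"
      using cube_coord_diff[OF t(2) centre_in_cube] by (intro infle) simp
    finally show "s \<in> (\<Union>t\<in>T. cbox (f (centre t) - (1 / 2) ^ fst t) (f (centre t) + (1 / 2) ^ fst t))"
      using t x by (auto simp: abs_le_iff intro!: bexI[of _ t])
  qed
  have "l / 4 = measure lborel {l / 4..<l / 2}" using l by simp
  also have "\<dots> \<le> measure lborel (\<Union>t\<in>T. cbox (f (centre t) - (1 / 2) ^ fst t) (f (centre t) + (1 / 2) ^ fst t))"
    using cov T(1) by (intro measure_mono_fmeasurable fmeasurable.finite_UN)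
      (auto intro: fmeasurable_cbox[where 'a = real, unfolded box_real])
  also have "\<dots> \<le> (\<Sum>t\<in>T. measure lborel (cbox (f (centre t) - (1 / 2) ^ fst t) (f (centre t) + (1 / 2) ^ fst t)))"
    using T by (intro measure_UNION_le) auto
  also have "\<dots> = (\<Sum>t\<in>T. 2 * (1 / 2) ^ fst t)"
    by (intro sum.cong) auto
  finally show ?thesis unfolding l_def by (simp flip: sum_distrib_left)
qed

subsection \<open>Amplification along good cubes\<close>

text \<open>Greedy choice of disjoint blocks: jumping over a counted block keeps the gain
  \<open>g\<close> from being claimed twice on the same levels. A block that does not fit above
  \<open>e\<close> earns nothing. \<open>J = 0\<close> is excluded for termination.\<close>

function steps :: "('n::finite cube \<Rightarrow> bool) \<Rightarrow> nat \<Rightarrow> nat \<Rightarrow> 'n cube \<Rightarrow> nat" where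
  "steps G J m e =
     (if J = 0 \<or> fst e < m + J then 0
      else if G (anc m e) then Suc (steps G J (m + J) e)
      else steps G J (Suc m) e)"
  by pat_completeness auto
termination
  by (relation "Wellfounded.measure (\<lambda>(G, J, m, e). Suc (fst e) - m)") auto

declare steps.simps [simp del]

text \<open>The starting level \<open>m\<close> is a parameter because the induction scans from the
  level of the current cube; \<open>weight_good\<close> and \<open>weight_bad\<close> describe what
  happens when that level moves down.\<close>

definition weight :: "real \<Rightarrow> ('n::finite cube \<Rightarrow> bool) \<Rightarrow> nat \<Rightarrow> nat \<Rightarrow> 'n cube \<Rightarrow> real" where
  "weight g G J m e = (1 / 2) ^ fst e / g ^ steps G J m e"

text \<open>A quarter of the side is the tolerance accepted by
  \<open>central_cube_cover_sum\<close>. Only the generation exactly \<open>J\<close> levels down is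
  tested, and this is what one non-porous scale provides.\<close>

definition good :: "(real ^ 'n::finite) set \<Rightarrow> nat \<Rightarrow> 'n cube \<Rightarrow> bool" where
  "good K J c \<longleftrightarrow> (\<forall>Q. below c Q \<longrightarrow> fst Q = fst c + J \<longrightarrow>
     (\<exists>y\<in>K. \<forall>i. \<bar>y $ i - centre Q $ i\<bar> \<le> (1 / 2) ^ fst Q / 4))"

lemma weight_nonneg: "0 \<le> g \<Longrightarrow> 0 \<le> weight g G J m e"
  by (simp add: weight_def)

lemma weight_early: "fst e < m + J \<Longrightarrow> weight g G J m e = (1 / 2) ^ fst e"
  by (simp add: weight_def steps.simps[of G J m e])

lemma weight_good:
  "0 < J \<Longrightarrow> m + J \<le> fst e \<Longrightarrow> G (anc m e) \<Longrightarrow> weight g G J m e = weight g G J (m + J) e / g"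
  by (simp add: weight_def steps.simps[of G J m e])

lemma weight_bad:
  assumes "\<not> G (anc m e)"
  shows "weight g G J m e = weight g G J (Suc m) e"
proof (cases "J = 0 \<or> fst e < m + J")
  case True
  then show ?thesis
    by (auto simp: weight_def steps.simps[of G J m e] steps.simps[of G J "Suc m" e])
next
  case False
  then show ?thesis
    using assms by (simp add: weight_def steps.simps[of G J m e])
qed

text \<open>A level that the scan passes singly is bad, so it is no \<open>k n\<close>; a jump skips
  a window of \<open>J\<close> levels, which holds at most \<open>L\<close> of the
  \<open>k n\<close>. Values with \<open>k n + J > fst e\<close> are left out because no block
  starting there fits.\<close>

lemma card_good_levels_le_steps:
  fixes k :: "nat \<Rightarrow> nat" and L :: real
  assumes fin: "finite N" and "0 < J"
    and window: "\<And>j. real (card {n \<in> N. j \<le> k n \<and> k n < j + J}) \<le> L"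
    and G: "\<And>n. n \<in> N \<Longrightarrow> k n \<le> fst e \<Longrightarrow> G (anc (k n) e)"
  shows "real (card {n \<in> N. m \<le> k n \<and> k n + J \<le> fst e}) \<le> L * real (steps G J m e)"
proof (induction "Suc (fst e) - m" arbitrary: m rule: less_induct)
  case less
  show ?case
  proof (cases "fst e < m + J")
    case True
    then have "{n \<in> N. m \<le> k n \<and> k n + J \<le> fst e} = {}" by auto
    then show ?thesis
      using True by (simp only: steps.simps[of G J m e]) simp
  next
    case False
    show ?thesis
    proof (cases "G (anc m e)")
      case True
      have "card {n \<in> N. m \<le> k n \<and> k n + J \<le> fst e}
          \<le> card ({n \<in> N. m \<le> k n \<and> k n < m + J} \<union> {n \<in> N. m + J \<le> k n \<and> k n + J \<le> fst e})"
        using fin by (intro card_mono) auto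
      also have "\<dots> \<le> card {n \<in> N. m \<le> k n \<and> k n < m + J} + card {n \<in> N. m + J \<le> k n \<and> k n + J \<le> fst e}"
        by (rule card_Un_le)
      finally have "real (card {n \<in> N. m \<le> k n \<and> k n + J \<le> fst e})
          \<le> real (card {n \<in> N. m \<le> k n \<and> k n < m + J}) + real (card {n \<in> N. m + J \<le> k n \<and> k n + J \<le> fst e})"
        by simp
      also have "\<dots> \<le> L + L * real (steps G J (m + J) e)"
        using window[of m] less[of "m + J"] False \<open>0 < J\<close> by (intro add_mono) auto
      also have "\<dots> = L * real (steps G J m e)"
        using False True \<open>0 < J\<close> by (simp add: steps.simps[of G J m e] algebra_simps)
      finally show ?thesis .
    next
      case bad: False
      have "Suc m \<le> k n" if "n \<in> N" "m \<le> k n" "k n + J \<le> fst e" for n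
      proof (rule ccontr)
        assume "\<not> Suc m \<le> k n"
        with that have "k n = m" by simp
        with G[OF that(1)] that bad show False by simp
      qed
      then have "{n \<in> N. m \<le> k n \<and> k n + J \<le> fst e} = {n \<in> N. Suc m \<le> k n \<and> k n + J \<le> fst e}"
        by (auto dest: Suc_leD)
      then show ?thesis
        using less[of "Suc m"] False bad \<open>0 < J\<close> by (simp add: steps.simps[of G J m e])
    qed
  qed
qed

text \<open>Replacing a cover by coarser cubes from the bottom up: at a good cube the descendants J levels
  deeper are all central, and together they outweigh the cube itself once their weight is divided by g.\<close>
lemma amplification_cube:
  fixes K :: "(real ^ 'n::finite) set" and J :: nat
  defines "g \<equiv> 2 ^ ((CARD('n) - 1) * J) / 8"
  assumes con: "connected K" and esc: "\<And>Q. m0 \<le> fst Q \<Longrightarrow> \<not> K \<subseteq> cube_set Q"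
    and J: "0 < J" and fin: "finite I" and cov: "K \<subseteq> (\<Union>e\<in>I. cube_set e)"
    and Q: "m0 \<le> fst Q" "\<And>e. e \<in> I \<Longrightarrow> below e Q \<Longrightarrow> e = Q"
  shows "\<exists>T. finite T \<and> (\<forall>t\<in>T. below Q t) \<and> K \<inter> cube_set Q \<subseteq> (\<Union>t\<in>T. cube_set t)
      \<and> (\<Sum>t\<in>T. (1 / 2) ^ fst t) \<le> (\<Sum>e\<in>{e\<in>I. below Q e}. weight g (good K J) J (fst Q) e)"
proof -
  define w where "w = weight g (good K J) J"
  have g: "g > 0" by (simp add: g_def)
  have w0: "0 \<le> w m e" for m e using g by (simp add: w_def weight_nonneg)
  obtain L where L: "\<And>e. e \<in> I \<Longrightarrow> fst e \<le> L"
    using fin finite_imageI[of I fst] by (meson finite_nat_set_iff_bounded_le imageI)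
  have dJ: "CARD('n) * J = (CARD('n) - 1) * J + J"
    by (cases "CARD('n)") auto
  show ?thesis
    unfolding w_def[symmetric] using Q
  proof (induction "Suc L - fst Q" arbitrary: Q rule: less_induct)
    case less
    \<comment> \<open>If the weight below \<open>Q\<close> is at least its side, \<open>Q\<close>
      alone is the cover; this settles covering cubes and good cubes.\<close>
    have single: "\<exists>T. finite T \<and> (\<forall>t\<in>T. below Q t) \<and> K \<inter> cube_set Q \<subseteq> (\<Union>t\<in>T. cube_set t)
      \<and> (\<Sum>t\<in>T. (1 / 2) ^ fst t) \<le> (\<Sum>e\<in>{e\<in>I. below Q e}. w (fst Q) e)"
      if "(1 / 2) ^ fst Q \<le> (\<Sum>e\<in>{e\<in>I. below Q e}. w (fst Q) e)"
      using that by (intro exI[of _ "{Q}"]) auto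
    have lev: "fst Q < fst e" if "below Q e" "e \<noteq> Q" for e
      using that below_eq[of Q e] below_level[of Q e] by fastforce
    consider "fst Q > L" | "Q \<in> I" | "fst Q \<le> L" "Q \<notin> I" "good K J Q" | "fst Q \<le> L" "Q \<notin> I" "\<not> good K J Q"
      by linarith
    then show ?case
    proof cases
      case 1
      \<comment> \<open>A member of \<open>I\<close> meeting \<open>Q\<close> is no deeper than
        \<open>L\<close>, hence a proper ancestor of \<open>Q\<close>, which is excluded.\<close>
      have "K \<inter> cube_set Q = {}"
      proof (rule ccontr)
        assume "K \<inter> cube_set Q \<noteq> {}"
        then obtain x e where "x \<in> cube_set Q" "e \<in> I" "x \<in> cube_set e" using cov by blast
        then show False
          using less.prems(2)[of e] L[of e] 1 below_if_common[of x e Q] by auto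
      qed
      then show ?thesis
        using w0 by (intro exI[of _ "{}"]) (auto intro!: sum_nonneg)
    next
      case 2
      have "(1 / 2) ^ fst Q = w (fst Q) Q" using J by (simp add: w_def weight_early)
      also have "\<dots> \<le> (\<Sum>e\<in>{e\<in>I. below Q e}. w (fst Q) e)"
        using 2 fin w0 by (intro member_le_sum) auto
      finally show ?thesis by (rule single)
    next
      case 3
      \<comment> \<open>The share of each of the 2^(dJ) descendants, d being the dimension. It
        equals (side of \<open>P\<close>)/8/g, which explains both the 8 and the exponent (d-1)J in
        \<open>g\<close>.\<close>
      define a :: real where "a = (1 / 2) ^ (fst Q + CARD('n) * J)"
      have "(1 / 2) ^ fst Q = 2 ^ (CARD('n) * J) * a"
        by (simp add: a_def power_add power_one_over)
      also have "\<dots> \<le> (\<Sum>e\<in>{e\<in>I. below Q e}. w (fst Q) e)"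
      proof (rule sum_below_descendants[OF fin w0])
        fix P assume P: "below Q P" "fst P = fst Q + J"
          "\<And>e. e \<in> I \<Longrightarrow> below Q e \<Longrightarrow> below e P \<Longrightarrow> e = P"
        have none: "e = P" if e: "e \<in> I" "below e P" for e
        proof (cases "fst Q \<le> fst e")
          case True
          then show ?thesis using P e below_linear by blast
        next
          case False
          then have "below e Q" using P e below_linear[of e P Q] by auto
          then show ?thesis using less.prems(2)[of e] e 3 by auto
        qed
        have lt: "Suc L - fst P < Suc L - fst Q" and mP: "m0 \<le> fst P"
          using P J 3 less.prems(1) by auto
        obtain T where T: "finite T" "K \<inter> cube_set P \<subseteq> (\<Union>t\<in>T. cube_set t)"
          "(\<Sum>t\<in>T. (1 / 2) ^ fst t) \<le> (\<Sum>e\<in>{e\<in>I. below P e}. w (fst P) e)"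
          using less.hyps[OF lt mP none] by blast
        obtain y where y: "y \<in> K" "\<And>i. \<bar>y $ i - centre P $ i\<bar> \<le> (1 / 2) ^ fst P / 4"
          using 3(3) P unfolding good_def by blast
        \<comment> \<open>The cover supplied by the induction hypothesis becomes a lower bound
          because \<open>P\<close> is central; connectedness enters the induction only here.\<close>
        have "(1 / 2) ^ fst P / 8 \<le> (\<Sum>t\<in>T. (1 / 2 :: real) ^ fst t)"
          using P less.prems(1) by (intro central_cube_cover_sum[OF con esc y T(1,2)]) auto
        also note T(3)
        finally have "(1 / 2) ^ fst P / 8 / g \<le> (\<Sum>e\<in>{e\<in>I. below P e}. w (fst P) e) / g"
          using g by (intro divide_right_mono) auto
        also have "(\<Sum>e\<in>{e\<in>I. below P e}. w (fst P) e) / g = (\<Sum>e\<in>{e\<in>I. below P e}. w (fst Q) e)"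
          unfolding sum_divide_distrib
        proof (rule sum.cong[OF refl])
          fix e assume "e \<in> {e\<in>I. below P e}"
          then have "below P e" by simp
          then have "below Q e" "fst P \<le> fst e" using P below_trans below_level by blast+
          then show "w (fst P) e / g = w (fst Q) e"
            using weight_good[of J "fst Q" e "good K J" g] J P 3 by (simp add: w_def below_def)
        qed
        finally have "(1 / 2) ^ fst P / 8 / g \<le> (\<Sum>e\<in>{e\<in>I. below P e}. w (fst Q) e)" .
        moreover have "(1 / 2) ^ fst P / 8 / g = a"
          unfolding a_def g_def P dJ by (simp add: power_add power_one_over)
        ultimately show "a \<le> (\<Sum>e\<in>{e\<in>I. below P e}. w (fst Q) e)"
          by simp
      next
        fix e assume e: "e \<in> I" "below Q e" "fst e < fst Q + J"
        then have le: "fst Q \<le> fst e" using below_level by blast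
        define k where "k = fst e - fst Q"
        have k: "fst e = fst Q + k" "k < J" using le e by (auto simp: k_def)
        \<comment> \<open>A member k levels below \<open>Q\<close> stands for 2^(d(J-k)) shares,
          together (side of \<open>Q\<close>)/2^(dk); its own weight (side of \<open>Q\<close>)/2^k
          is no smaller.\<close>
        have "CARD('n) * J = CARD('n) * k + CARD('n) * (J - k)"
          using k by (simp flip: add_mult_distrib2)
        then have "2 ^ (CARD('n) * (fst Q + J - fst e)) * a = (1 / 2) ^ (fst Q + CARD('n) * k)"
          using k by (simp add: a_def power_add power_one_over)
        also have "\<dots> \<le> (1 / 2) ^ fst e"
          unfolding k by (intro power_decreasing) auto
        finally show "2 ^ (CARD('n) * (fst Q + J - fst e)) * a \<le> w (fst Q) e"
          using e by (simp add: w_def weight_early)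
      qed
      finally show ?thesis by (rule single)
    next
      case 4
      \<comment> \<open>At a bad cube the covers of the children are united; by
        \<open>weight_bad\<close> the scan may start one level lower with the same weights.\<close>
      have "\<exists>T. finite T \<and> (\<forall>t\<in>T. below c t) \<and> K \<inter> cube_set c \<subseteq> (\<Union>t\<in>T. cube_set t)
          \<and> (\<Sum>t\<in>T. (1 / 2) ^ fst t) \<le> (\<Sum>e\<in>{e\<in>I. below c e}. w (fst c) e)"
        if c: "c \<in> children Q" for c
      proof (rule less.hyps)
        have cQ: "below Q c" "fst c = Suc (fst Q)" using c by (auto simp: children_def)
        then show "Suc L - fst c < Suc L - fst Q" "m0 \<le> fst c" using 4 less.prems(1) by auto
        fix e assume e: "e \<in> I" "below e c"
        show "e = c"
        proof (cases "fst e \<le> fst Q")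
          case True
          then have "below e Q" using e cQ below_linear by blast
          then show ?thesis using less.prems(2)[of e] e 4 by auto
        next
          case False
          then show ?thesis using e cQ below_level[of e c] below_eq[of e c] by auto
        qed
      qed
      then have "\<forall>c\<in>children Q. \<exists>T. finite T \<and> (\<forall>t\<in>T. below c t) \<and> K \<inter> cube_set c \<subseteq> (\<Union>t\<in>T. cube_set t)
          \<and> (\<Sum>t\<in>T. (1 / 2) ^ fst t) \<le> (\<Sum>e\<in>{e\<in>I. below c e}. w (fst c) e)" by blast
      from bchoice[OF this] obtain T where T: "\<And>c. c \<in> children Q \<Longrightarrow> finite (T c)"
        "\<And>c t. c \<in> children Q \<Longrightarrow> t \<in> T c \<Longrightarrow> below c t"
        "\<And>c. c \<in> children Q \<Longrightarrow> K \<inter> cube_set c \<subseteq> (\<Union>t\<in>T c. cube_set t)"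
        "\<And>c. c \<in> children Q \<Longrightarrow> (\<Sum>t\<in>T c. (1 / 2) ^ fst t) \<le> (\<Sum>e\<in>{e\<in>I. below c e}. w (fst c) e)"
        by auto
      have disj: "T c \<inter> T c' = {}" if "c \<in> children Q" "c' \<in> children Q" "c \<noteq> c'" for c c'
        using that T(2)[OF that(1)] T(2)[OF that(2)] unfolding children_def below_def by fastforce
      have "(\<Sum>t\<in>(\<Union>c\<in>children Q. T c). (1 / 2 :: real) ^ fst t) = (\<Sum>c\<in>children Q. \<Sum>t\<in>T c. (1 / 2) ^ fst t)"
        using T(1) disj by (intro sum.UNION_disjoint) (auto simp: finite_children)
      also have "\<dots> \<le> (\<Sum>c\<in>children Q. \<Sum>e\<in>{e\<in>I. below c e}. w (fst c) e)"
        using T(4) by (rule sum_mono)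
      also have "\<dots> = (\<Sum>c\<in>children Q. \<Sum>e\<in>{e\<in>I. below c e}. w (fst Q) e)"
      proof (intro sum.cong refl)
        fix c e assume "c \<in> children Q" "e \<in> {e\<in>I. below c e}"
        then have "anc (fst Q) e = Q" "fst c = Suc (fst Q)"
          using below_trans[of Q c e] by (auto simp: children_def below_def)
        then show "w (fst c) e = w (fst Q) e"
          using 4 weight_bad[of "good K J" "fst Q" e g J] by (simp add: w_def)
      qed
      also have "\<dots> = (\<Sum>e\<in>{e\<in>I. below Q e}. w (fst Q) e)"
        using sum_below_children[OF fin, of Q] 4 by simp
      finally have le: "(\<Sum>t\<in>(\<Union>c\<in>children Q. T c). (1 / 2) ^ fst t) \<le> (\<Sum>e\<in>{e\<in>I. below Q e}. w (fst Q) e)" .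
      have "K \<inter> cube_set Q \<subseteq> (\<Union>t\<in>(\<Union>c\<in>children Q. T c). cube_set t)"
      proof
        fix x assume x: "x \<in> K \<inter> cube_set Q"
        have "below Q (cell (Suc (fst Q)) x)"
          using x by (intro below_if_common[of x]) auto
        then have "cell (Suc (fst Q)) x \<in> children Q" by (simp add: children_def)
        with T(3)[OF this] x show "x \<in> (\<Union>t\<in>(\<Union>c\<in>children Q. T c). cube_set t)"
          by fastforce
      qed
      moreover have "below Q t" if "t \<in> (\<Union>c\<in>children Q. T c)" for t
        using that T(2) below_trans[of Q _ t] unfolding children_def by blast
      moreover have "finite (\<Union>c\<in>children Q. T c)"
        using T(1) finite_children by blast
      ultimately show ?thesis using le by blast
    qed
  qed
qed

text \<open>\<open>amplification_cube\<close> wants no covering cube properly above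
  \<open>Q\<close>. So only the outermost members of \<open>I\<close> are kept, and it is applied to
  the ancestors of level \<open>m0\<close>.\<close>

lemma amplification:
  fixes K :: "(real ^ 'n::finite) set" and J :: nat
  defines "g \<equiv> 2 ^ ((CARD('n) - 1) * J) / 8"
  assumes con: "connected K" and esc: "\<And>Q. m0 \<le> fst Q \<Longrightarrow> \<not> K \<subseteq> cube_set Q"
    and J: "0 < J" and fin: "finite I" and cov: "K \<subseteq> (\<Union>e\<in>I. cube_set e)"
    and lev: "\<And>e. e \<in> I \<Longrightarrow> m0 \<le> fst e"
  shows "\<exists>T. finite T \<and> (\<forall>t\<in>T. m0 \<le> fst t) \<and> K \<subseteq> (\<Union>t\<in>T. cube_set t)
      \<and> (\<Sum>t\<in>T. (1 / 2) ^ fst t) \<le> (\<Sum>e\<in>I. weight g (good K J) J m0 e)"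
proof -
  define w where "w = weight g (good K J) J"
  have w0: "0 \<le> w m e" for m e by (simp add: w_def g_def weight_nonneg)
  define top where "top = anc m0 ` I"
  have fint: "finite top" using fin by (simp add: top_def)
  define I' where "I' = {e\<in>I. \<forall>d\<in>I. below d e \<longrightarrow> d = e}"
  have finI': "finite I'" using fin by (simp add: I'_def)
  have cov': "K \<subseteq> (\<Union>e\<in>I'. cube_set e)"
  proof
    fix x assume "x \<in> K"
    then have "\<exists>e. e \<in> I \<and> x \<in> cube_set e" using cov by blast
    then obtain e where e: "e \<in> I" "x \<in> cube_set e"
      and min: "\<And>d. d \<in> I \<Longrightarrow> x \<in> cube_set d \<Longrightarrow> fst e \<le> fst d"
      using ex_has_least_nat[of "\<lambda>e. e \<in> I \<and> x \<in> cube_set e" _ fst] by metis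
    have "d = e" if d: "d \<in> I" "below d e" for d
    proof -
      have "x \<in> cube_set d" using cube_set_mono d e by blast
      then have "fst e = fst d" using min[OF d(1)] d below_level[of d e] by fastforce
      then show ?thesis using d(2) below_eq[of d e] by simp
    qed
    then show "x \<in> (\<Union>e\<in>I'. cube_set e)" using e unfolding I'_def by blast
  qed
  have "\<exists>T. finite T \<and> (\<forall>t\<in>T. below Q t) \<and> K \<inter> cube_set Q \<subseteq> (\<Union>t\<in>T. cube_set t)
      \<and> (\<Sum>t\<in>T. (1 / 2) ^ fst t) \<le> (\<Sum>e\<in>{e\<in>I'. below Q e}. w (fst Q) e)"
    if Q: "Q \<in> top" for Q
    unfolding w_def g_def
  proof (rule amplification_cube[OF con esc J finI' cov'])
    show "m0 \<le> fst Q" using Q by (auto simp: top_def)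
    fix e assume "e \<in> I'" "below e Q"
    then show "e = Q"
      using lev[of e] Q below_level[of e Q] below_eq[of e Q] by (auto simp: top_def I'_def)
  qed
  then have "\<forall>c\<in>top. \<exists>T. finite T \<and> (\<forall>t\<in>T. below c t) \<and> K \<inter> cube_set c \<subseteq> (\<Union>t\<in>T. cube_set t)
      \<and> (\<Sum>t\<in>T. (1 / 2) ^ fst t) \<le> (\<Sum>e\<in>{e\<in>I'. below c e}. w (fst c) e)" by blast
  from bchoice[OF this] obtain T where T: "\<And>c. c \<in> top \<Longrightarrow> finite (T c)"
    "\<And>c t. c \<in> top \<Longrightarrow> t \<in> T c \<Longrightarrow> below c t"
    "\<And>c. c \<in> top \<Longrightarrow> K \<inter> cube_set c \<subseteq> (\<Union>t\<in>T c. cube_set t)"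
    "\<And>c. c \<in> top \<Longrightarrow> (\<Sum>t\<in>T c. (1 / 2) ^ fst t) \<le> (\<Sum>e\<in>{e\<in>I'. below c e}. w (fst c) e)"
    by auto
  have topl: "fst c = m0" if "c \<in> top" for c using that by (auto simp: top_def)
  have disj: "T c \<inter> T c' = {}" if "c \<in> top" "c' \<in> top" "c \<noteq> c'" for c c'
    using that T(2)[OF that(1)] T(2)[OF that(2)] topl unfolding below_def by fastforce
  have "(\<Sum>t\<in>(\<Union>c\<in>top. T c). (1 / 2 :: real) ^ fst t) = (\<Sum>c\<in>top. \<Sum>t\<in>T c. (1 / 2) ^ fst t)"
    using T(1) disj fint by (intro sum.UNION_disjoint) auto
  also have "\<dots> \<le> (\<Sum>c\<in>top. \<Sum>e\<in>{e\<in>I'. below c e}. w m0 e)"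
    using T(4) topl by (intro sum_mono) fastforce
  also have "\<dots> = (\<Sum>e\<in>(\<Union>c\<in>top. {e\<in>I'. below c e}). w m0 e)"
    using finI' fint topl by (intro sum.UNION_disjoint[symmetric]) (auto simp: below_def)
  also have "\<dots> \<le> (\<Sum>e\<in>I. w m0 e)"
    using fin w0 by (intro sum_mono2) (auto simp: I'_def)
  finally have le: "(\<Sum>t\<in>(\<Union>c\<in>top. T c). (1 / 2) ^ fst t) \<le> (\<Sum>e\<in>I. w m0 e)" .
  have "K \<subseteq> (\<Union>t\<in>(\<Union>c\<in>top. T c). cube_set t)"
  proof
    fix x assume x: "x \<in> K"
    then obtain e where e: "e \<in> I" "x \<in> cube_set e" using cov by blast
    then have "cell (fst e) x = e" by (simp add: cube_set_def)
    then have "anc m0 e = cell m0 x" using anc_cell[OF lev[OF e(1)], of x] by simp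
    then have "cell m0 x \<in> top" using e by (metis imageI top_def)
    with T(3)[OF this] x show "x \<in> (\<Union>t\<in>(\<Union>c\<in>top. T c). cube_set t)"
      by fastforce
  qed
  moreover have "m0 \<le> fst t" if "t \<in> (\<Union>c\<in>top. T c)" for t
  proof -
    from that obtain c where "c \<in> top" "t \<in> T c" by blast
    then show ?thesis using T(2) topl below_level by metis
  qed
  moreover have "finite (\<Union>c\<in>top. T c)"
    using T(1) fint by blast
  ultimately show ?thesis using le unfolding w_def by blast
qed

subsection \<open>Hausdorff measure and covers by balls and cubes\<close>

lemma hausdorff_premeasure_le:
  assumes "A \<subseteq> (\<Union>i. U i)" "\<And>i. bounded (U i)" "\<And>i. diameter (U i) \<le> \<delta>"
  shows "hausdorff_premeasure s \<delta> A \<le> (\<Sum>i::nat. diam_pow s (U i))"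
  unfolding hausdorff_premeasure_def using assms by (intro INF_lower) auto

lemma hausdorff_premeasure_mono:
  "A \<subseteq> B \<Longrightarrow> \<delta>' \<le> \<delta> \<Longrightarrow> hausdorff_premeasure s \<delta> A \<le> hausdorff_premeasure s \<delta>' B"
  unfolding hausdorff_premeasure_def
  by (rule INF_superset_mono) (fastforce intro: order_trans)+

lemma hausdorff_premeasure_le_measure:
  "0 < \<delta> \<Longrightarrow> hausdorff_premeasure s \<delta> A \<le> hausdorff_measure s A"
  unfolding hausdorff_measure_def by (intro SUP_upper) auto

lemma hausdorff_measure_mono: "A \<subseteq> B \<Longrightarrow> hausdorff_measure s A \<le> hausdorff_measure s B"
  unfolding hausdorff_measure_def by (intro SUP_mono) (auto intro: hausdorff_premeasure_mono)

lemma diam_pow_antimono: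
  assumes "bounded U" "diameter U \<le> 1" "0 \<le> s" "s \<le> s'"
  shows "diam_pow s' U \<le> diam_pow s U"
proof -
  have "diameter U powr s' \<le> diameter U powr s" "diameter U powr s' \<le> 1"
    using assms diameter_ge_0[OF assms(1)] by (auto intro: powr_mono' powr_le1)
  then show ?thesis
    using assms by (auto simp: diam_pow_def intro: ennreal_leI)
qed

lemma hausdorff_measure_0_mono:
  assumes "hausdorff_measure s A = 0" "0 \<le> s" "s \<le> s'"
  shows "hausdorff_measure s' A = 0"
proof -
  have "hausdorff_premeasure s' \<delta> A \<le> 0" if "\<delta> > 0" for \<delta>
  proof -
    have "hausdorff_premeasure s' \<delta> A \<le> hausdorff_premeasure s' (min \<delta> 1) A"
      by (rule hausdorff_premeasure_mono) auto
    also have "\<dots> \<le> hausdorff_premeasure s (min \<delta> 1) A"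
      unfolding hausdorff_premeasure_def using assms
      by (intro INF_mono) (force intro!: suminf_le diam_pow_antimono)
    also have "\<dots> \<le> hausdorff_measure s A"
      using that by (intro hausdorff_premeasure_le_measure) auto
    finally show ?thesis using assms by simp
  qed
  then show ?thesis
    unfolding hausdorff_measure_def by (metis SUP_least greaterThan_iff le_zero_eq)
qed

text \<open>Balls replace the covering sets: open ones for the sake of compactness, and centred in
  \<open>A\<close> because non-porosity is known only at points of \<open>W\<close>.\<close>

lemma hausdorff_ball_sequence:
  fixes A :: "'a::metric_space set"
  assumes s: "0 < s" and d: "0 < \<delta>" and e: "0 < \<eta>" and A: "A \<noteq> {}" and b: "0 \<le> b"
    and pre: "hausdorff_premeasure s \<delta> A < ennreal b"
  shows "\<exists>x r. (\<forall>i::nat. x i \<in> A \<and> 0 < r i \<and> r i \<le> 2 * \<delta>) \<and> A \<subseteq> (\<Union>i. ball (x i) (r i)) \<and>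
      (\<forall>n. (\<Sum>i<n. r i powr s) \<le> 2 powr s * (b + \<eta>))"
proof -
  obtain U :: "nat \<Rightarrow> 'a set" where U: "A \<subseteq> (\<Union>i. U i)" "\<And>i. bounded (U i)" "\<And>i. diameter (U i) \<le> \<delta>"
    and sU: "(\<Sum>i. diam_pow s (U i)) < ennreal b"
    using pre unfolding hausdorff_premeasure_def INF_less_iff by auto
  \<comment> \<open>A set of diameter 0 still needs a ball of positive radius; the s-th powers of
    these \<open>\<tau> i\<close> add up to at most \<open>\<eta>\<close>.\<close>
  define \<tau> where "\<tau> i = min \<delta> ((\<eta> / 2 ^ Suc i) powr (1 / s))" for i :: nat
  define r where "r i = 2 * max (diameter (U i)) (\<tau> i)" for i
  obtain a where a: "a \<in> A" using A by blast
  \<comment> \<open>If \<open>U i\<close> misses \<open>A\<close>, the point \<open>a\<close> is a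
    mere default; the ball is useless, but its radius is already paid for.\<close>
  define x where "x i = (if A \<inter> U i = {} then a else SOME y. y \<in> A \<inter> U i)" for i
  have xU: "x i \<in> A \<inter> U i" if "A \<inter> U i \<noteq> {}" for i
    using that someI_ex[of "\<lambda>y. y \<in> A \<inter> U i"] unfolding x_def by auto
  have xA: "x i \<in> A" for i
    using xU[of i] a by (cases "A \<inter> U i = {}") (auto simp: x_def)
  have dU: "0 \<le> diameter (U i)" for i using U(2) by (rule diameter_ge_0)
  have \<tau>: "0 < \<tau> i" "\<tau> i \<le> \<delta>" for i using d e by (auto simp: \<tau>_def)
  have r: "0 < r i" "r i \<le> 2 * \<delta>" for i
    using \<tau>[of i] U(3)[of i] by (auto simp: r_def)
  have "A \<subseteq> (\<Union>i. ball (x i) (r i))"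
  proof
    fix y assume y: "y \<in> A"
    then obtain i where i: "y \<in> U i" using U by blast
    then have "x i \<in> U i" using xU[of i] y by blast
    then have "dist (x i) y \<le> diameter (U i)" using diameter_bounded_bound[OF U(2)] i by blast
    also have "\<dots> < r i" using dU[of i] \<tau>[of i] by (auto simp: r_def)
    finally show "y \<in> (\<Union>i. ball (x i) (r i))" by auto
  qed
  moreover have "(\<Sum>i<n. r i powr s) \<le> 2 powr s * (b + \<eta>)" for n
  proof -
    have "r i powr s \<le> 2 powr s * (diameter (U i) powr s + \<eta> / 2 ^ Suc i)" for i
    proof -
      have "\<tau> i powr s \<le> ((\<eta> / 2 ^ Suc i) powr (1 / s)) powr s"
        using \<tau>[of i] s by (intro powr_mono2) (auto simp: \<tau>_def)
      also have "\<dots> = \<eta> / 2 ^ Suc i" using s e by (simp add: powr_powr)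
      finally have "max (diameter (U i)) (\<tau> i) powr s \<le> diameter (U i) powr s + \<eta> / 2 ^ Suc i"
        using e by (auto simp: max_def intro: add_increasing2 add_increasing)
      then show ?thesis using dU[of i] \<tau>[of i] unfolding r_def by (simp add: powr_mult)
    qed
    then have "(\<Sum>i<n. r i powr s) \<le> (\<Sum>i<n. 2 powr s * (diameter (U i) powr s + \<eta> / 2 ^ Suc i))"
      by (rule sum_mono)
    also have "\<dots> = 2 powr s * ((\<Sum>i<n. diameter (U i) powr s) + (\<Sum>i<n. \<eta> / 2 ^ Suc i))"
      by (simp add: sum_distrib_left sum.distrib distrib_left)
    also have "(\<Sum>i<n. \<eta> / 2 ^ Suc i) = \<eta> - \<eta> / 2 ^ n"
      by (induction n) (auto simp: field_simps)
    also have "(\<Sum>i<n. diameter (U i) powr s) \<le> b"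
    proof -
      have "ennreal (\<Sum>i<n. diameter (U i) powr s) = (\<Sum>i<n. ennreal (diameter (U i) powr s))"
        by (simp add: sum_ennreal)
      also have "\<dots> \<le> (\<Sum>i<n. diam_pow s (U i))"
        using s by (intro sum_mono) (auto simp: diam_pow_def)
      also have "\<dots> \<le> (\<Sum>i. diam_pow s (U i))" by (intro sum_le_suminf) auto
      finally have "ennreal (\<Sum>i<n. diameter (U i) powr s) \<le> ennreal b" using sU by simp
      then show ?thesis using b by (simp add: ennreal_le_iff)
    qed
    also have "2 powr s * (b + (\<eta> - \<eta> / 2 ^ n)) \<le> 2 powr s * (b + \<eta>)"
      using e by (intro mult_left_mono) auto
    finally show ?thesis by simp
  qed
  ultimately show ?thesis using xA r by blast
qed

lemma sum_UN_le:
  fixes u :: "'b \<Rightarrow> real"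
  assumes "finite C" "\<And>i. i \<in> C \<Longrightarrow> finite (S i)" "\<And>e. 0 \<le> u e"
  shows "(\<Sum>e\<in>(\<Union>i\<in>C. S i). u e) \<le> (\<Sum>i\<in>C. \<Sum>e\<in>S i. u e)"
  using assms(1,2)
proof (induction C rule: finite_induct)
  case (insert i C)
  have "(\<Sum>e\<in>S i \<union> (\<Union>j\<in>C. S j). u e) \<le> (\<Sum>e\<in>S i. u e) + (\<Sum>e\<in>(\<Union>j\<in>C. S j). u e)"
    using insert assms(3) by (subst sum_Un) (auto intro: sum_nonneg)
  then show ?case using insert by simp
qed simp

text \<open>A set of balls also serves the empty \<open>A\<close>. Repetitions in the sequence can
  only make sums over the set smaller, and bounds on finite subfamilies suffice, since only those
  survive compactness.\<close>

lemma hausdorff_ball_cover: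
  fixes A :: "'a::metric_space set"
  assumes s: "0 < s" and d: "0 < \<delta>" and e: "0 < \<eta>" and b: "0 \<le> b"
    and pre: "hausdorff_premeasure s \<delta> A < ennreal b"
  shows "\<exists>\<B>. (\<forall>(x, r)\<in>\<B>. x \<in> A \<and> 0 < r \<and> r \<le> 2 * \<delta>) \<and> A \<subseteq> (\<Union>(x, r)\<in>\<B>. ball x r) \<and>
      (\<forall>F. finite F \<longrightarrow> F \<subseteq> \<B> \<longrightarrow> (\<Sum>(x, r)\<in>F. r powr s) \<le> 2 powr s * (b + \<eta>))"
proof (cases "A = {}")
  case True
  then show ?thesis using b e by (intro exI[of _ "{}"]) auto
next
  case False
  obtain x r where xr: "\<And>i::nat. x i \<in> A \<and> 0 < r i \<and> r i \<le> 2 * \<delta>" "A \<subseteq> (\<Union>i. ball (x i) (r i))"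
    "\<And>n. (\<Sum>i<n. r i powr s) \<le> 2 powr s * (b + \<eta>)"
    using hausdorff_ball_sequence[OF s d e False b pre] by blast
  have "(\<Sum>(x, r)\<in>F. r powr s) \<le> 2 powr s * (b + \<eta>)"
    if F: "finite F" "F \<subseteq> range (\<lambda>i. (x i, r i))" for F
  proof -
    obtain C where C: "finite C" "F = (\<lambda>i. (x i, r i)) ` C" using finite_subset_image[OF F] by blast
    then obtain n where n: "C \<subseteq> {..<n}" using finite_nat_iff_bounded by blast
    have "(\<Sum>(x, r)\<in>F. r powr s) \<le> (\<Sum>i\<in>C. r i powr s)"
      unfolding C using sum_image_le[of C "\<lambda>(x, r). r powr s" "\<lambda>i. (x i, r i)"] C by (simp add: o_def)
    also have "\<dots> \<le> (\<Sum>i<n. r i powr s)" using n by (intro sum_mono2) auto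
    also have "\<dots> \<le> 2 powr s * (b + \<eta>)" by (rule xr)
    finally show ?thesis .
  qed
  then show ?thesis using xr(1,2) by (intro exI[of _ "range (\<lambda>i. (x i, r i))"]) auto
qed

text \<open>\<open>A\<close> is a countable union of parts on which the gauge
  \<open>\<delta>\<close> is bounded below; each part is null and gets a geometric share of
  \<open>\<eta>\<close>.\<close>

lemma hausdorff_null_gauge_cover:
  fixes A :: "'a::metric_space set"
  assumes s: "0 < s" and null: "hausdorff_measure s A = 0"
    and \<delta>: "\<And>x. x \<in> A \<Longrightarrow> 0 < \<delta> x" and e: "0 < \<eta>"
  shows "\<exists>\<B>. (\<forall>(x, r)\<in>\<B>. x \<in> A \<and> 0 < r \<and> r \<le> \<delta> x) \<and> A \<subseteq> (\<Union>(x, r)\<in>\<B>. ball x r) \<and>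
      (\<forall>F. finite F \<longrightarrow> F \<subseteq> \<B> \<longrightarrow> (\<Sum>(x, r)\<in>F. r powr s) \<le> \<eta>)"
proof -
  define A' where "A' M = {x\<in>A. inverse (real (Suc M)) \<le> \<delta> x}" for M
  \<comment> \<open>The divisors cancel the factor 2^s and the doubling in
    \<open>hausdorff_ball_cover\<close>, leaving \<open>\<eta> / 2 ^ Suc M\<close> for part
    \<open>M\<close>.\<close>
  define \<theta> where "\<theta> M = \<eta> / 2 ^ Suc M / 2 powr s / 2" for M :: nat
  have \<theta>: "\<theta> M > 0" for M using e by (simp add: \<theta>_def)
  define P where "P M \<B> \<longleftrightarrow> (\<forall>(x, r)\<in>\<B>. x \<in> A' M \<and> 0 < r \<and> r \<le> 2 * (inverse (real (Suc M)) / 2)) \<and>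
      A' M \<subseteq> (\<Union>(x, r)\<in>\<B>. ball x r) \<and>
      (\<forall>F. finite F \<longrightarrow> F \<subseteq> \<B> \<longrightarrow> (\<Sum>(x, r)\<in>F. r powr s) \<le> 2 powr s * (\<theta> M + \<theta> M))" for M \<B>
  have "\<exists>\<B>. P M \<B>" for M
    unfolding P_def
  proof (rule hausdorff_ball_cover[OF s _ \<theta>])
    have "hausdorff_premeasure s (inverse (real (Suc M)) / 2) (A' M) \<le> hausdorff_measure s (A' M)"
      by (intro hausdorff_premeasure_le_measure) simp
    also have "\<dots> \<le> hausdorff_measure s A" by (intro hausdorff_measure_mono) (auto simp: A'_def)
    also have "\<dots> < ennreal (\<theta> M)" using null \<theta>[of M] by simp
    finally show "hausdorff_premeasure s (inverse (real (Suc M)) / 2) (A' M) < ennreal (\<theta> M)" .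
  qed (use \<theta>[of M] in auto)
  then obtain \<B> where B: "\<And>M. P M (\<B> M)" by metis
  have B1: "x \<in> A' M \<and> 0 < r \<and> r \<le> inverse (real (Suc M))" if "(x, r) \<in> \<B> M" for M x r
    using B[of M] that by (auto simp: P_def)
  have B2: "A' M \<subseteq> (\<Union>(x, r)\<in>\<B> M. ball x r)" for M
    using B[of M] by (simp add: P_def)
  have B3: "(\<Sum>(x, r)\<in>F. r powr s) \<le> 2 powr s * (\<theta> M + \<theta> M)" if "finite F" "F \<subseteq> \<B> M" for M F
    using B[of M] that by (simp add: P_def)
  have A': "\<exists>M. x \<in> A' M" if x: "x \<in> A" for x
  proof -
    obtain M where "inverse (real (Suc M)) < \<delta> x" using reals_Archimedean[OF \<delta>[OF x]] by blast
    then show ?thesis using x by (intro exI[of _ M]) (simp add: A'_def)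
  qed
  have "A \<subseteq> (\<Union>(x, r)\<in>(\<Union>M. \<B> M). ball x r)"
  proof
    fix x assume "x \<in> A"
    then obtain M where "x \<in> A' M" using A' by blast
    then show "x \<in> (\<Union>(x, r)\<in>(\<Union>M. \<B> M). ball x r)" using B2[of M] by blast
  qed
  moreover have "x \<in> A \<and> 0 < r \<and> r \<le> \<delta> x" if "(x, r) \<in> (\<Union>M. \<B> M)" for x r
  proof -
    from that obtain M where "(x, r) \<in> \<B> M" by blast
    from B1[OF this] show ?thesis by (auto simp: A'_def)
  qed
  moreover have "(\<Sum>(x, r)\<in>F. r powr s) \<le> \<eta>" if F: "finite F" "F \<subseteq> (\<Union>M. \<B> M)" for F
  proof -
    obtain C where C: "finite C" "F \<subseteq> (\<Union>M\<in>C. \<B> M)"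
      using finite_subset_Union[OF F(1), of "range \<B>"] F(2) finite_subset_image[of _ \<B> UNIV] by metis
    then obtain n where n: "C \<subseteq> {..<n}" using finite_nat_iff_bounded by blast
    have "F = (\<Union>M\<in>{..<n}. F \<inter> \<B> M)" using C n by blast
    then have "(\<Sum>(x, r)\<in>F. r powr s) = (\<Sum>(x, r)\<in>(\<Union>M\<in>{..<n}. F \<inter> \<B> M). r powr s)" by simp
    also have "\<dots> \<le> (\<Sum>M<n. \<Sum>(x, r)\<in>F \<inter> \<B> M. r powr s)"
      using F by (intro sum_UN_le) auto
    also have "\<dots> \<le> (\<Sum>M<n. 2 powr s * (\<theta> M + \<theta> M))"
      using F by (intro sum_mono B3) auto
    also have "\<dots> = (\<Sum>M<n. \<eta> / 2 ^ Suc M)" by (simp add: \<theta>_def)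
    also have "\<dots> = \<eta> - \<eta> / 2 ^ n"
      by (induction n) (auto simp: field_simps)
    also have "\<dots> \<le> \<eta>" using e by simp
    finally show ?thesis .
  qed
  ultimately show ?thesis by (intro exI[of _ "\<Union>M. \<B> M"]) auto
qed

text \<open>A ball of radius at most the side length may straddle several cubes, but the 3^d cubes
  around the cell of its centre contain it.\<close>

definition nbrs :: "nat \<Rightarrow> real ^ 'n::finite \<Rightarrow> 'n cube set" where
  "nbrs p x = {c. fst c = p \<and> (\<forall>i. \<bar>snd c $ i - \<lfloor>2 ^ p * x $ i\<rfloor>\<bar> \<le> 1)}"

lemma finite_nbrs: "finite (nbrs p (x :: real ^ 'n::finite))"
  and card_nbrs: "card (nbrs p (x :: real ^ 'n::finite)) = 3 ^ CARD('n)"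
proof -
  have "nbrs p x = Pair p ` {u. \<forall>i. u $ i \<in> {\<lfloor>2 ^ p * x $ i\<rfloor> - 1..\<lfloor>2 ^ p * x $ i\<rfloor> + 1}}"
    by (auto simp: nbrs_def image_iff abs_le_iff algebra_simps)
  then show "finite (nbrs p x)" "card (nbrs p x) = 3 ^ CARD('n)"
    using card_vec_family[of "\<lambda>i. {\<lfloor>2 ^ p * x $ i\<rfloor> - 1..\<lfloor>2 ^ p * x $ i\<rfloor> + 1}"]
    by (auto simp: card_image inj_on_def intro!: finite_imageI)
qed

lemma fst_nbrs: "c \<in> nbrs p x \<Longrightarrow> fst c = p"
  by (simp add: nbrs_def)

lemma ball_subset_nbrs:
  fixes x :: "real ^ 'n::finite"
  assumes "r \<le> (1 / 2) ^ p"
  shows "ball x r \<subseteq> (\<Union>c\<in>nbrs p x. cube_set c)"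
proof
  fix y assume y: "y \<in> ball x r"
  have "\<bar>\<lfloor>2 ^ p * y $ i\<rfloor> - \<lfloor>2 ^ p * x $ i\<rfloor>\<bar> \<le> 1" for i
  proof -
    have "\<bar>y $ i - x $ i\<bar> \<le> dist y x" by (metis component_le_norm_cart dist_norm vector_minus_component)
    also have "\<dots> < (1 / 2) ^ p" using y assms by (simp add: dist_commute)
    finally have "2 ^ p * \<bar>y $ i - x $ i\<bar> < 1" by (simp add: power_one_over field_simps)
    then have "\<bar>2 ^ p * y $ i - 2 ^ p * x $ i\<bar> < 1" by (simp add: abs_mult flip: right_diff_distrib)
    then show ?thesis by linarith
  qed
  then have "cell p y \<in> nbrs p x" by (simp add: nbrs_def cell_def)
  then show "y \<in> (\<Union>c\<in>nbrs p x. cube_set c)" using mem_cube_set_cell by blast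
qed

lemma nbrs_coord_diff:
  fixes x :: "real ^ 'n::finite"
  assumes c: "c \<in> nbrs p x" and y: "y \<in> cube_set c"
  shows "\<bar>y $ i - x $ i\<bar> \<le> 2 * (1 / 2) ^ p"
proof -
  have "cell p y = c" using c y by (simp add: cube_set_def nbrs_def)
  then have "snd c $ i = \<lfloor>2 ^ p * y $ i\<rfloor>" by (auto simp: cell_def)
  then have "\<bar>\<lfloor>2 ^ p * y $ i\<rfloor> - \<lfloor>2 ^ p * x $ i\<rfloor>\<bar> \<le> 1"
    using c unfolding nbrs_def by (metis (mono_tags) mem_Collect_eq)
  then have "\<bar>2 ^ p * y $ i - 2 ^ p * x $ i\<bar> \<le> 2" by linarith
  then have "2 ^ p * \<bar>y $ i - x $ i\<bar> \<le> 2" by (simp add: abs_mult flip: right_diff_distrib)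
  then show ?thesis by (simp add: power_one_over field_simps)
qed

lemma ex_dyadic_level:
  fixes r :: real
  assumes "0 < r" "r \<le> 1"
  shows "\<exists>p. r \<le> (1 / 2) ^ p \<and> (1 / 2) ^ p < 2 * r"
proof -
  obtain n where n: "(1 / 2) ^ n < r" "\<And>k. k < n \<Longrightarrow> \<not> (1 / 2) ^ k < r"
    using exists_least_iff[of "\<lambda>n. (1 / 2) ^ n < r"] real_arch_pow_inv[of r "1 / 2"] assms by auto
  then obtain p where "n = Suc p" using assms by (cases n) auto
  then show ?thesis using n(1) n(2)[of p] by (intro exI[of _ p]) auto
qed

lemma bounded_cube_set: "bounded (cube_set c)"
  and diameter_cube_set: "diameter (cube_set (c :: 'n::finite cube)) \<le> real CARD('n) * (1 / 2) ^ fst c"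
proof -
  have le: "dist x y \<le> real CARD('n) * (1 / 2) ^ fst c" if "x \<in> cube_set c" "y \<in> cube_set c" for x y
  proof -
    have "dist x y \<le> (\<Sum>i\<in>UNIV. \<bar>(x - y) $ i\<bar>)" unfolding dist_norm by (rule norm_le_l1_cart)
    also have "\<dots> \<le> (\<Sum>i\<in>(UNIV :: 'n set). (1 / 2) ^ fst c)"
      using cube_coord_diff[OF that] by (intro sum_mono) simp
    finally show ?thesis by simp
  qed
  then show "bounded (cube_set c)" unfolding bounded_def by blast
  show "diameter (cube_set c) \<le> real CARD('n) * (1 / 2) ^ fst c"
    using le by (intro diameter_le) (auto simp: dist_norm)
qed

text \<open>\<open>T\<close> may be infinite, as the family of maximal good cubes can be. Cubes form
  a countable type, so \<open>T\<close> can be enumerated, and bounds on finite sums pass to the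
  series.\<close>

lemma hausdorff_premeasure_cubes:
  fixes A :: "(real ^ 'n::finite) set"
  assumes cov: "A \<subseteq> (\<Union>c\<in>T. cube_set c)" and lev: "\<And>c. c \<in> T \<Longrightarrow> m \<le> fst c"
    and sm: "\<And>F. finite F \<Longrightarrow> F \<subseteq> T \<Longrightarrow> (\<Sum>c\<in>F. (1 / 2) ^ fst c) \<le> b"
  shows "hausdorff_premeasure 1 (real CARD('n) * (1 / 2) ^ m) A \<le> ennreal (real CARD('n) * b)"
proof (cases "T = {}")
  case True
  have "0 \<le> b" using sm[of "{}"] by simp
  have "hausdorff_premeasure 1 (real CARD('n) * (1 / 2) ^ m) A \<le> (\<Sum>i::nat. diam_pow 1 ({} :: (real ^ 'n) set))"
    using cov True by (intro hausdorff_premeasure_le) auto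
  then show ?thesis by (simp add: diam_pow_def)
next
  case False
  define V where "V = to_nat_on T ` T"
  have cT: "countable T" by (rule countableI_type)
  \<comment> \<open>Outside the codes \<open>V\<close> the value of \<open>from_nat_into T\<close>
    is arbitrary; the empty set there prevents repeated cubes.\<close>
  define U where "U i = (if i \<in> V then cube_set (from_nat_into T i) else {})" for i
  have inv: "from_nat_into T (to_nat_on T c) = c" if "c \<in> T" for c using cT that by simp
  have fT: "from_nat_into T i \<in> T" for i using False by (rule from_nat_into)
  have "A \<subseteq> (\<Union>i. U i)"
  proof
    fix x assume "x \<in> A"
    then obtain c where "c \<in> T" "x \<in> cube_set c" using cov by blast
    then have "x \<in> U (to_nat_on T c)" by (auto simp: U_def V_def inv)
    then show "x \<in> (\<Union>i. U i)" by blast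
  qed
  moreover have "bounded (U i)" for i by (simp add: U_def bounded_cube_set)
  moreover have "diameter (U i) \<le> real CARD('n) * (1 / 2) ^ m" for i
  proof (cases "i \<in> V")
    case True
    have "diameter (U i) \<le> real CARD('n) * (1 / 2) ^ fst (from_nat_into T i)"
      using True diameter_cube_set by (simp add: U_def)
    also have "\<dots> \<le> real CARD('n) * (1 / 2) ^ m"
      using lev[OF fT[of i]] by (intro mult_left_mono power_decreasing) auto
    finally show ?thesis .
  qed (simp add: U_def)
  ultimately have "hausdorff_premeasure 1 (real CARD('n) * (1 / 2) ^ m) A \<le> (\<Sum>i. diam_pow 1 (U i))"
    by (rule hausdorff_premeasure_le)
  also have "\<dots> \<le> ennreal (real CARD('n) * b)"
  proof (rule suminf_le_const)
    show "summable (\<lambda>i. diam_pow 1 (U i))" by simp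
    fix n
    have dp: "diam_pow 1 (U i) \<le> ennreal (real CARD('n) * (1 / 2) ^ fst (from_nat_into T i))" for i
      using diameter_cube_set[of "from_nat_into T i"] diameter_ge_0[OF bounded_cube_set[of "from_nat_into T i"]]
      by (auto simp: diam_pow_def U_def intro!: ennreal_leI)
    have inj: "inj_on (from_nat_into T) V"
      using inv by (auto simp: inj_on_def V_def)
    have "(\<Sum>i<n. diam_pow 1 (U i)) = (\<Sum>i\<in>{..<n} \<inter> V. diam_pow 1 (U i))"
      by (rule sum.mono_neutral_right) (auto simp: U_def diam_pow_def)
    also have "\<dots> \<le> (\<Sum>i\<in>{..<n} \<inter> V. ennreal (real CARD('n) * (1 / 2) ^ fst (from_nat_into T i)))"
      using dp by (rule sum_mono)
    also have "\<dots> = ennreal (\<Sum>i\<in>{..<n} \<inter> V. real CARD('n) * (1 / 2) ^ fst (from_nat_into T i))"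
      by (rule sum_ennreal) auto
    also have "(\<Sum>i\<in>{..<n} \<inter> V. real CARD('n) * (1 / 2) ^ fst (from_nat_into T i))
        = (\<Sum>c\<in>from_nat_into T ` ({..<n} \<inter> V). real CARD('n) * (1 / 2) ^ fst c)"
      by (subst sum.reindex) (auto intro: inj_on_subset[OF inj])
    also have "\<dots> = real CARD('n) * (\<Sum>c\<in>from_nat_into T ` ({..<n} \<inter> V). (1 / 2) ^ fst c)"
      by (simp add: sum_distrib_left)
    also have "ennreal \<dots> \<le> ennreal (real CARD('n) * b)"
      using fT by (intro ennreal_leI mult_left_mono sm) auto
    finally show "(\<Sum>i<n. diam_pow 1 (U i)) \<le> ennreal (real CARD('n) * b)" .
  qed
  finally show ?thesis .
qed

subsection \<open>Continua of finite length\<close>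

text \<open>Compactness yields a finite cover by cubes. The side is at least the radius for
  covering, and below twice the radius for the later sums.\<close>

lemma cover_by_nbrs:
  fixes K :: "(real ^ 'n::finite) set"
  assumes K: "compact K" "K \<subseteq> (\<Union>(x, r)\<in>\<B>. ball x r)"
    and r: "\<forall>b\<in>\<B>. 0 < snd b \<and> snd b \<le> (1 / 2) ^ Suc m"
  shows "\<exists>F p. finite F \<and> F \<subseteq> \<B> \<and> K \<subseteq> (\<Union>e\<in>(\<Union>b\<in>F. nbrs (p b) (fst b)). cube_set e)
    \<and> (\<forall>b\<in>\<B>. snd b \<le> (1 / 2) ^ p b \<and> (1 / 2) ^ p b < 2 * snd b)"
proof -
  have "\<exists>p. snd b \<le> (1 / 2) ^ p \<and> (1 / 2) ^ p < 2 * snd b" if "b \<in> \<B>" for b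
  proof (rule ex_dyadic_level)
    have "(1 / 2 :: real) ^ Suc m \<le> 1" by (rule power_le_one) auto
    then show "0 < snd b" "snd b \<le> 1" using r that by auto
  qed
  then obtain p where p: "\<And>b. b \<in> \<B> \<Longrightarrow> snd b \<le> (1 / 2) ^ p b \<and> (1 / 2) ^ p b < 2 * snd b"
    by metis
  obtain F where F: "F \<subseteq> \<B>" "finite F" "K \<subseteq> (\<Union>b\<in>F. ball (fst b) (snd b))"
    using compactE_image[OF K(1), of \<B> "\<lambda>b. ball (fst b) (snd b)"] K(2) by (auto simp: case_prod_unfold)
  have "(\<Union>b\<in>F. ball (fst b) (snd b)) \<subseteq> (\<Union>e\<in>(\<Union>b\<in>F. nbrs (p b) (fst b)). cube_set e)"
  proof
    fix x assume "x \<in> (\<Union>b\<in>F. ball (fst b) (snd b))"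
    then obtain b where b: "b \<in> F" "x \<in> ball (fst b) (snd b)" by blast
    then have "ball (fst b) (snd b) \<subseteq> (\<Union>e\<in>nbrs (p b) (fst b). cube_set e)"
      using ball_subset_nbrs p F(1) by blast
    then show "x \<in> (\<Union>e\<in>(\<Union>b\<in>F. nbrs (p b) (fst b)). cube_set e)" using b by blast
  qed
  then show ?thesis using F p by (intro exI[of _ F] exI[of _ p]) auto
qed

text \<open>A cube may be almost twice as large as its ball; hence the \<open>Suc m\<close> in the
  bounds on radii.\<close>

lemma dyadic_level_gt:
  assumes "(1 / 2 :: real) ^ p < 2 * r" "r \<le> (1 / 2) ^ Suc m"
  shows "m < p"
proof (rule ccontr)
  assume "\<not> m < p"
  then have "(1 / 2 :: real) ^ m \<le> (1 / 2) ^ p" by (intro power_decreasing) auto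
  moreover have "(1 / 2 :: real) ^ Suc m = (1 / 2) ^ m / 2" by simp
  ultimately show False using assms by linarith
qed

lemma sum_nbrs_le:
  fixes x :: "real ^ 'n::finite"
  assumes "\<And>e. e \<in> nbrs p x \<Longrightarrow> u e \<le> v"
  shows "(\<Sum>e\<in>nbrs p x. u e) \<le> 3 ^ CARD('n) * (v :: real)"
  using sum_bounded_above[of "nbrs p x" u v] assms by (simp add: card_nbrs)

text \<open>The constant collects 3^d cubes per ball, a side below twice the radius, and a sum of
  radii of at most 2(b + 1).\<close>

lemma finite_length_cube_cover:
  fixes K :: "(real ^ 'n::finite) set"
  assumes K: "compact K" and b: "0 \<le> b" "hausdorff_measure 1 K < ennreal b"
  shows "\<exists>T. finite T \<and> (\<forall>t\<in>T. m \<le> fst t) \<and> K \<subseteq> (\<Union>t\<in>T. cube_set t) \<and>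
    (\<Sum>t\<in>T. (1 / 2) ^ fst t) \<le> 3 ^ CARD('n) * (4 * (b + 1))"
proof -
  \<comment> \<open>Half the wanted radius is prescribed, because
    \<open>hausdorff_ball_cover\<close> doubles it.\<close>
  have "hausdorff_premeasure 1 ((1 / 2) ^ Suc m / 2) K < ennreal b"
    using b(2) hausdorff_premeasure_le_measure[of "(1 / 2) ^ Suc m / 2" 1 K] by simp
  from hausdorff_ball_cover[OF _ _ zero_less_one b(1) this]
  obtain \<B> where B0: "\<forall>(x, r)\<in>\<B>. x \<in> K \<and> 0 < r \<and> r \<le> 2 * ((1 / 2) ^ Suc m / 2)"
    and B: "K \<subseteq> (\<Union>(x, r)\<in>\<B>. ball x r)"
    and B3: "\<forall>F. finite F \<longrightarrow> F \<subseteq> \<B> \<longrightarrow> (\<Sum>(x, r)\<in>F. r powr 1) \<le> 2 powr 1 * (b + 1)"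
    by auto
  have B1: "\<forall>b\<in>\<B>. 0 < snd b \<and> snd b \<le> (1 / 2) ^ Suc m" using B0 by auto
  obtain F p where F: "finite F" "F \<subseteq> \<B>" "K \<subseteq> (\<Union>e\<in>(\<Union>b\<in>F. nbrs (p b) (fst b)). cube_set e)"
    and p0: "\<forall>b\<in>\<B>. snd b \<le> (1 / 2) ^ p b \<and> (1 / 2) ^ p b < 2 * snd b"
    using cover_by_nbrs[OF K B B1] by (elim exE conjE) (rule that)
  have p: "snd b \<le> (1 / 2) ^ p b \<and> (1 / 2) ^ p b < 2 * snd b" if "b \<in> \<B>" for b
    using p0 that by blast
  define T where "T = (\<Union>b\<in>F. nbrs (p b) (fst b))"
  have "(\<Sum>t\<in>T. (1 / 2 :: real) ^ fst t) \<le> (\<Sum>b\<in>F. \<Sum>t\<in>nbrs (p b) (fst b). (1 / 2) ^ fst t)"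
    unfolding T_def using F(1) finite_nbrs by (intro sum_UN_le) auto
  also have "\<dots> \<le> (\<Sum>b\<in>F. 3 ^ CARD('n) * (2 * snd b powr 1))"
  proof (intro sum_mono sum_nbrs_le)
    fix b t assume b: "b \<in> F" "t \<in> nbrs (p b) (fst b)"
    have "b \<in> \<B>" "0 < snd b" using B1 F(2) b(1) by blast+
    then show "(1 / 2 :: real) ^ fst t \<le> 2 * snd b powr 1"
      using p[of b] fst_nbrs[OF b(2)] by simp
  qed
  also have "\<dots> = 3 ^ CARD('n) * 2 * (\<Sum>(x, r)\<in>F. r powr 1)"
    unfolding sum_distrib_left by (intro sum.cong) (auto simp: mult_ac)
  also have "\<dots> \<le> 3 ^ CARD('n) * 2 * (2 powr 1 * (b + 1))"
    using B3 F(1,2) by (intro mult_left_mono) auto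
  finally have "(\<Sum>t\<in>T. (1 / 2) ^ fst t) \<le> 3 ^ CARD('n) * (4 * (b + 1))"
    by (simp add: algebra_simps)
  moreover have "m \<le> fst t" if t: "t \<in> T" for t
  proof -
    from t obtain b where b: "b \<in> F" "t \<in> nbrs (p b) (fst b)" by (auto simp: T_def)
    then have "b \<in> \<B>" using F by blast
    then have "m < p b" using p[of b] B1 by (intro dyadic_level_gt[of "p b" "snd b"]) auto
    then show ?thesis using fst_nbrs[OF b(2)] by simp
  qed
  moreover have "finite T" using F(1) finite_nbrs by (auto simp: T_def)
  ultimately show ?thesis using F(3) unfolding T_def[symmetric] by blast
qed

text \<open>All of \<open>T\<close> lies at least \<open>J\<close> levels deeper than
  \<open>c\<close>, so no member is met early in \<open>sum_below_descendants\<close>, and each of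
  the 2^(dJ) central descendants contributes an eighth of its side.\<close>

lemma good_cube_fine_cover_sum:
  fixes K :: "(real ^ 'n::finite) set" and J :: nat
  assumes con: "connected K" and esc: "\<And>Q. fst c \<le> fst Q \<Longrightarrow> \<not> K \<subseteq> cube_set Q"
    and T: "finite T" "K \<subseteq> (\<Union>t\<in>T. cube_set t)" "\<And>t. t \<in> T \<Longrightarrow> fst c + J \<le> fst t"
    and c: "good K J c"
  shows "2 ^ ((CARD('n) - 1) * J) / 8 * (1 / 2) ^ fst c \<le> (\<Sum>t\<in>{t\<in>T. below c t}. (1 / 2 :: real) ^ fst t)"
proof -
  have dJ: "CARD('n) * J = (CARD('n) - 1) * J + J"
    by (cases "CARD('n)") auto
  have "2 ^ (CARD('n) * J) * ((1 / 2) ^ (fst c + J) / 8) \<le> (\<Sum>t\<in>{t\<in>T. below c t}. (1 / 2 :: real) ^ fst t)"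
  proof (rule sum_below_descendants[OF T(1)])
    fix P assume P: "below c P" "fst P = fst c + J"
    obtain y where y: "y \<in> K" "\<And>i. \<bar>y $ i - centre P $ i\<bar> \<le> (1 / 2) ^ fst P / 4"
      using c P unfolding good_def by blast
    have "K \<inter> cube_set P \<subseteq> (\<Union>t\<in>{t\<in>T. below P t}. cube_set t)"
    proof
      fix x assume x: "x \<in> K \<inter> cube_set P"
      then obtain t where "t \<in> T" "x \<in> cube_set t" using T(2) by blast
      moreover from this have "below P t"
        using x T(3)[of t] P by (intro below_if_common[of x]) auto
      ultimately show "x \<in> (\<Union>t\<in>{t\<in>T. below P t}. cube_set t)"
        by blast
    qed
    then have "(1 / 2) ^ fst P / 8 \<le> (\<Sum>t\<in>{t\<in>T. below P t}. (1 / 2 :: real) ^ fst t)"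
      using P T(1) by (intro central_cube_cover_sum[OF con esc y]) auto
    then show "(1 / 2) ^ (fst c + J) / 8 \<le> (\<Sum>t\<in>{t\<in>T. below P t}. (1 / 2 :: real) ^ fst t)"
      by (simp add: P)
  qed (use T(3) in force)+
  moreover have "2 ^ (CARD('n) * J) * ((1 / 2) ^ (fst c + J) / 8) = 2 ^ ((CARD('n) - 1) * J) / 8 * (1 / 2 :: real) ^ fst c"
    unfolding dJ by (simp add: power_add power_one_over)
  ultimately show ?thesis by simp
qed

text \<open>In a nearly optimal fine cover, replacing everything inside a good cube by the cube itself saves
  at least the side length of that cube, so the good cubes have small total side length.\<close>
lemma finite_length_good_null:
  fixes K W :: "(real ^ 'n::finite) set" and J :: nat
  assumes K: "compact K" "connected K" and fin: "hausdorff_measure 1 K < \<infinity>"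
    and esc: "\<And>Q. m0 \<le> fst Q \<Longrightarrow> \<not> K \<subseteq> cube_set Q"
    and g: "16 \<le> (2 :: real) ^ ((CARD('n) - 1) * J)"
    and W: "\<And>z m. z \<in> W \<Longrightarrow> \<exists>j\<ge>m. good K J (cell j z)"
  shows "hausdorff_measure 1 W = 0"
proof -
  define covers where "covers m = {T. finite T \<and> (\<forall>t\<in>T. m \<le> fst t) \<and> K \<subseteq> (\<Union>t\<in>T. cube_set t)}" for m
  define len where "len T = (\<Sum>t\<in>T. (1 / 2 :: real) ^ fst t)" for T :: "'n cube set"
  \<comment> \<open>The optimal length at levels from \<open>m\<close> on increases with
    \<open>m\<close> and stays bounded because \<open>K\<close> has finite length; \<open>H\<close>
    is its limit. Beyond some level all these optima agree up to \<open>\<eta>\<close>.\<close>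
  define h where "h m = Inf (len ` covers m)" for m
  define b where "b = enn2real (hausdorff_measure 1 K) + 1"
  have b: "0 \<le> b" "hausdorff_measure 1 K < ennreal b"
  proof -
    show "0 \<le> b" by (simp add: b_def)
    have "hausdorff_measure 1 K = ennreal (enn2real (hausdorff_measure 1 K))" using fin by simp
    also have "\<dots> < ennreal b" unfolding b_def by (intro ennreal_lessI add_nonneg_pos) auto
    finally show "hausdorff_measure 1 K < ennreal b" .
  qed
  define B where "B = 3 ^ CARD('n) * (4 * (b + 1))"
  have len0: "0 \<le> len T" for T by (simp add: len_def sum_nonneg)
  have bdd: "bdd_below (len ` covers m)" for m using len0 by (intro bdd_belowI[of _ 0]) auto
  have ne: "\<exists>T\<in>covers m. len T \<le> B" for m
    using finite_length_cube_cover[OF K(1) b, of m] unfolding covers_def len_def B_def by blast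
  have hB: "h m \<le> B" for m
    using ne[of m] bdd[of m] unfolding h_def by (meson cINF_lower2)
  have hmono: "h m \<le> h m'" if "m \<le> m'" for m m'
    unfolding h_def using ne[of m'] bdd that
    by (intro cInf_superset_mono image_mono) (auto simp: covers_def)
  have bddh: "bdd_above (range h)" using hB by (intro bdd_aboveI[of _ B]) auto
  define H where "H = Sup (range h)"
  have hH: "h m \<le> H" for m unfolding H_def using bddh by (intro cSup_upper) auto
  have main: "hausdorff_premeasure 1 \<delta> W \<le> ennreal (real CARD('n) * (2 * \<eta>))"
    if \<delta>: "0 < \<delta>" and \<eta>: "0 < \<eta>" for \<delta> \<eta>
  proof -
    have "\<exists>m. H - \<eta> < h m"
      using less_cSup_iff[of "range h" "H - \<eta>"] bddh \<eta> by (auto simp: H_def)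
    then obtain ma where ma: "H - \<eta> < h ma" by blast
    obtain mb where mb: "(1 / 2) ^ mb < \<delta> / real CARD('n)"
      using real_arch_pow_inv[of "\<delta> / real CARD('n)" "1 / 2"] \<delta> by auto
    define m1 where "m1 = Max {m0, ma, mb}"
    have m1: "m0 \<le> m1" "ma \<le> m1" "mb \<le> m1" by (auto simp: m1_def)
    have m1\<delta>: "real CARD('n) * (1 / 2) ^ m1 \<le> \<delta>"
    proof -
      have "(1 / 2 :: real) ^ m1 \<le> (1 / 2) ^ mb" using m1 by (intro power_decreasing) auto
      then have "(1 / 2 :: real) ^ m1 \<le> \<delta> / real CARD('n)" using mb by linarith
      then show ?thesis by (simp add: field_simps)
    qed
    \<comment> \<open>Outermost good cubes from level \<open>m1\<close> on: they cover
      \<open>W\<close>, and no two are nested, so the parts of a fine cover inside them are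
      disjoint.\<close>
    define R where "R = {c. m1 \<le> fst c \<and> good K J c \<and> (\<forall>d. m1 \<le> fst d \<longrightarrow> good K J d \<longrightarrow> below d c \<longrightarrow> d = c)}"
    have "W \<subseteq> (\<Union>c\<in>R. cube_set c)"
    proof
      fix z assume "z \<in> W"
      then have "\<exists>j. m1 \<le> j \<and> good K J (cell j z)" using W by blast
      then obtain j where j: "m1 \<le> j" "good K J (cell j z)"
        and least: "\<And>i. m1 \<le> i \<Longrightarrow> good K J (cell i z) \<Longrightarrow> j \<le> i"
        using ex_has_least_nat[of "\<lambda>j. m1 \<le> j \<and> good K J (cell j z)" _ "\<lambda>j. j"] by metis
      have "d = cell j z" if d: "m1 \<le> fst d" "good K J d" "below d (cell j z)" for d
      proof -
        have "z \<in> cube_set d" using cube_set_mono[OF d(3)] mem_cube_set_cell by blast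
        then have dz: "cell (fst d) z = d" by (simp add: cube_set_def)
        then have "j \<le> fst d" using least d by simp
        then have "fst d = j" using below_level[OF d(3)] by simp
        then show ?thesis using dz by simp
      qed
      then have "cell j z \<in> R" using j by (simp add: R_def)
      then show "z \<in> (\<Union>c\<in>R. cube_set c)" using mem_cube_set_cell by blast
    qed
    moreover have "(\<Sum>c\<in>F. (1 / 2) ^ fst c) \<le> 2 * \<eta>" if F: "finite F" "F \<subseteq> R" for F
    proof -
      \<comment> \<open>As \<open>R\<close> may be infinite, a finite part \<open>F\<close> is
        treated, and \<open>T\<close> is then taken at least \<open>J\<close> levels finer than all
        of \<open>F\<close>.\<close>
      obtain M where M: "\<And>c. c \<in> F \<Longrightarrow> fst c + J \<le> M"
        using finite_imageI[OF F(1), of "\<lambda>c. fst c + J"] by (meson finite_nat_set_iff_bounded_le imageI)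
      have "Inf (len ` covers (max M m1)) < H + \<eta>"
        using hH[of "max M m1"] \<eta> unfolding h_def by simp
      then obtain T where T: "T \<in> covers (max M m1)" "len T < H + \<eta>"
        using cInf_lessD[of "len ` covers (max M m1)"] ne[of "max M m1"] by auto
      define S where "S c = {t\<in>T. below c t}" for c
      define T0 where "T0 = T - (\<Union>c\<in>F. S c)"
      have finT: "finite T" using T by (simp add: covers_def)
      have disj: "S c \<inter> S d = {}" if cd: "c \<in> F" "d \<in> F" "c \<noteq> d" for c d
      proof (rule ccontr)
        assume "S c \<inter> S d \<noteq> {}"
        then obtain t where "below c t" "below d t" by (auto simp: S_def)
        then have "below c d \<or> below d c"
          using below_linear nat_le_linear by blast
        moreover have "e = e'" if "e \<in> F" "e' \<in> F" "below e e'" for e e'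
          using that F(2) unfolding R_def by blast
        ultimately show False using cd by metis
      qed
      have "2 * len F \<le> (\<Sum>c\<in>F. len (S c))"
        unfolding len_def sum_distrib_left
      proof (rule sum_mono)
        fix c assume c: "c \<in> F"
        then have cR: "m1 \<le> fst c" "good K J c" using F by (auto simp: R_def)
        \<comment> \<open>Here 16/8 = 2: inside a good cube the cover is at least twice as long as
          the side.\<close>
        have "2 * (1 / 2) ^ fst c \<le> 2 ^ ((CARD('n) - 1) * J) / 8 * (1 / 2 :: real) ^ fst c"
          using g by (intro mult_right_mono) auto
        also have "\<dots> \<le> (\<Sum>t\<in>S c. (1 / 2) ^ fst t)"
          unfolding S_def
        proof (rule good_cube_fine_cover_sum[OF K(2) _ finT _ _ cR(2)])
          show "\<not> K \<subseteq> cube_set Q" if "fst c \<le> fst Q" for Q using esc[of Q] that cR m1 by simp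
          show "K \<subseteq> (\<Union>t\<in>T. cube_set t)" using T by (simp add: covers_def)
          show "fst c + J \<le> fst t" if "t \<in> T" for t
            using T M[OF c] that by (fastforce simp: covers_def)
        qed
        finally show "2 * (1 / 2) ^ fst c \<le> (\<Sum>t\<in>S c. (1 / 2 :: real) ^ fst t)" .
      qed
      also have "\<dots> = len (\<Union>c\<in>F. S c)"
        unfolding len_def using F finT disj by (intro sum.UNION_disjoint[symmetric]) (auto simp: S_def)
      finally have gain: "2 * len F \<le> len (\<Union>c\<in>F. S c)" .
      have split: "len T = len T0 + len (\<Union>c\<in>F. S c)"
        unfolding len_def T0_def using finT by (intro sum.subset_diff) (auto simp: S_def)
      have "K \<subseteq> (\<Union>t\<in>F \<union> T0. cube_set t)"
      proof
        fix x assume "x \<in> K"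
        then obtain t where t: "t \<in> T" "x \<in> cube_set t" using T by (auto simp: covers_def)
        show "x \<in> (\<Union>t\<in>F \<union> T0. cube_set t)"
        proof (cases "t \<in> T0")
          case False
          then obtain c where "c \<in> F" "below c t" using t by (auto simp: T0_def S_def)
          then show ?thesis using t cube_set_mono by blast
        qed (use t in blast)
      qed
      then have "F \<union> T0 \<in> covers m1"
        using T F finT unfolding covers_def T0_def R_def by auto
      \<comment> \<open>This competitor is longer than \<open>H - \<eta>\<close>, yet its length is
        at most \<open>len T - len F < H + \<eta> - len F\<close>.\<close>
      then have "h m1 \<le> len (F \<union> T0)" unfolding h_def using bdd by (intro cInf_lower) auto
      also have "\<dots> \<le> len F + len T0"
        unfolding len_def using F finT by (subst sum_Un) (auto simp: T0_def intro: sum_nonneg)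
      finally have "H - \<eta> < len F + len T0" using ma hmono[OF m1(2)] by simp
      then have "len F \<le> 2 * \<eta>" using gain split T(2) by simp
      then show ?thesis by (simp add: len_def)
    qed
    ultimately have "hausdorff_premeasure 1 (real CARD('n) * (1 / 2) ^ m1) W \<le> ennreal (real CARD('n) * (2 * \<eta>))"
      by (intro hausdorff_premeasure_cubes[where T = R]) (auto simp: R_def)
    moreover have "hausdorff_premeasure 1 \<delta> W \<le> hausdorff_premeasure 1 (real CARD('n) * (1 / 2) ^ m1) W"
      using m1\<delta> by (intro hausdorff_premeasure_mono) auto
    ultimately show ?thesis by simp
  qed
  have "hausdorff_premeasure 1 \<delta> W \<le> 0" if \<delta>: "0 < \<delta>" for \<delta>
  proof (rule ennreal_le_epsilon)
    fix e :: real assume e: "0 < e"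
    have "hausdorff_premeasure 1 \<delta> W \<le> ennreal (real CARD('n) * (2 * (e / (2 * real CARD('n)))))"
      using e \<delta> by (intro main) auto
    then show "hausdorff_premeasure 1 \<delta> W \<le> 0 + ennreal e" by simp
  qed
  then show ?thesis
    unfolding hausdorff_measure_def by (metis SUP_least greaterThan_iff le_zero_eq)
qed

subsection \<open>Continua of infinite length\<close>

text \<open>In \<open>decay\<close> the constant is uniform over \<open>W\<close>; only the level
  \<open>P\<close> depends on the point, and the gauge cover takes care of that. The starting level
  \<open>m\<close> is left free because it is fixed only after \<open>\<delta>\<close>.\<close>

lemma infinite_length_contradiction:
  fixes K :: "(real ^ 'n::finite) set" and J :: nat
  defines "g \<equiv> 2 ^ ((CARD('n) - 1) * J) / 8"
  assumes K: "compact K" "connected K" "K = W \<union> E"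
    and E: "hausdorff_measure 1 E < \<infinity>" and inf: "hausdorff_measure 1 K = \<infinity>"
    and W: "hausdorff_measure s W = 0" "0 < s"
    and esc: "\<And>Q. mK \<le> fst Q \<Longrightarrow> \<not> K \<subseteq> cube_set Q"
    and J: "0 < J" and g: "1 \<le> g"
    and decay: "\<And>m. \<exists>C. \<forall>z\<in>W. \<exists>P. \<forall>p\<ge>P. \<forall>e\<in>nbrs p z.
        weight g (good K J) J m e \<le> C * ((1 / 2) ^ p) powr s"
  shows False
proof -
  define b where "b = enn2real (hausdorff_measure 1 E) + 1"
  have b: "0 \<le> b" "hausdorff_measure 1 E < ennreal b"
  proof -
    show "0 \<le> b" by (simp add: b_def)
    have "hausdorff_measure 1 E = ennreal (enn2real (hausdorff_measure 1 E))" using E by simp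
    also have "\<dots> < ennreal b" unfolding b_def by (intro ennreal_lessI add_nonneg_pos) auto
    finally show "hausdorff_measure 1 E < ennreal b" .
  qed
  \<comment> \<open>A bound for the weight of the whole cover: the first summand is for the balls of
    \<open>E\<close>, the 1 for those of \<open>W\<close>.\<close>
  define B where "B = 3 ^ CARD('n) * (4 * (b + 1)) + 1"
  have B0: "0 < B" using b by (simp add: B_def add_nonneg_pos)
  have "ennreal (real CARD('n) * B) < hausdorff_measure 1 K" using inf by simp
  then obtain \<delta> where \<delta>: "0 < \<delta>" "ennreal (real CARD('n) * B) < hausdorff_premeasure 1 \<delta> K"
    unfolding hausdorff_measure_def less_SUP_iff by auto
  obtain mb where mb: "(1 / 2) ^ mb < \<delta> / real CARD('n)"
    using real_arch_pow_inv[of "\<delta> / real CARD('n)" "1 / 2"] \<delta> by auto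
  define m where "m = max mK mb"
  have m\<delta>: "real CARD('n) * (1 / 2) ^ m \<le> \<delta>"
  proof -
    have "(1 / 2 :: real) ^ m \<le> (1 / 2) ^ mb" unfolding m_def by (intro power_decreasing) auto
    then have "(1 / 2 :: real) ^ m \<le> \<delta> / real CARD('n)" using mb by linarith
    then show ?thesis by (simp add: field_simps)
  qed
  have long: "B < (\<Sum>t\<in>T. (1 / 2) ^ fst t)"
    if T: "finite T" "\<And>t. t \<in> T \<Longrightarrow> m \<le> fst t" "K \<subseteq> (\<Union>t\<in>T. cube_set t)" for T
  proof (rule ccontr)
    assume "\<not> ?thesis"
    then have le: "(\<Sum>t\<in>T. (1 / 2) ^ fst t) \<le> B" by simp
    have "hausdorff_premeasure 1 \<delta> K \<le> hausdorff_premeasure 1 (real CARD('n) * (1 / 2) ^ m) K"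
      using m\<delta> by (intro hausdorff_premeasure_mono) auto
    also have "\<dots> \<le> ennreal (real CARD('n) * B)"
    proof (rule hausdorff_premeasure_cubes[OF T(3,2)])
      fix F assume "F \<subseteq> T"
      then have "(\<Sum>t\<in>F. (1 / 2 :: real) ^ fst t) \<le> (\<Sum>t\<in>T. (1 / 2) ^ fst t)"
        using T(1) by (intro sum_mono2) auto
      then show "(\<Sum>t\<in>F. (1 / 2) ^ fst t) \<le> B" using le by linarith
    qed auto
    finally show False using \<delta>(2) by simp
  qed
  define w where "w = weight g (good K J) J m"
  have w0: "0 \<le> w e" for e using g by (simp add: w_def weight_nonneg)
  obtain C where "\<forall>z\<in>W. \<exists>P. \<forall>p\<ge>P. \<forall>e\<in>nbrs p z. w e \<le> C * ((1 / 2) ^ p) powr s"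
    using decay[of m] unfolding w_def by blast
  then have "\<exists>P. \<forall>z\<in>W. \<forall>p\<ge>P z. \<forall>e\<in>nbrs p z. w e \<le> C * ((1 / 2) ^ p) powr s"
    by (rule bchoice)
  then obtain P where P: "\<And>z p e. z \<in> W \<Longrightarrow> P z \<le> p \<Longrightarrow> e \<in> nbrs p z \<Longrightarrow> w e \<le> C * ((1 / 2) ^ p) powr s"
    by blast
  \<comment> \<open>\<open>2 powr s\<close> because a cube may be almost twice its ball,
    \<open>max\<close> for positivity; \<open>\<eta>\<close> then limits the contribution of
    \<open>W\<close> to 1.\<close>
  define C' where "C' = max C 1 * 2 powr s"
  have C': "0 < C'" by (simp add: C'_def)
  define \<eta> where "\<eta> = 1 / (3 ^ CARD('n) * C')"
  have \<eta>: "0 < \<eta>" using C' by (simp add: \<eta>_def)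
  obtain BW where BW: "\<forall>(x, r)\<in>BW. x \<in> W \<and> 0 < r \<and> r \<le> (1 / 2) ^ Suc (max m (P x))"
    "W \<subseteq> (\<Union>(x, r)\<in>BW. ball x r)"
    "\<forall>F. finite F \<longrightarrow> F \<subseteq> BW \<longrightarrow> (\<Sum>(x, r)\<in>F. r powr s) \<le> \<eta>"
    using hausdorff_null_gauge_cover[OF W(2,1) _ \<eta>, of "\<lambda>x. (1 / 2) ^ Suc (max m (P x))",
        OF zero_less_power[OF half_gt_zero[OF zero_less_one]]] by blast
  have "hausdorff_premeasure 1 ((1 / 2) ^ Suc m / 2) E < ennreal b"
    using b(2) hausdorff_premeasure_le_measure[of "(1 / 2) ^ Suc m / 2" 1 E] by simp
  from hausdorff_ball_cover[OF _ _ zero_less_one b(1) this]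
  obtain BE where BE: "\<forall>(x, r)\<in>BE. x \<in> E \<and> 0 < r \<and> r \<le> 2 * ((1 / 2) ^ Suc m / 2)"
    "E \<subseteq> (\<Union>(x, r)\<in>BE. ball x r)"
    "\<forall>F. finite F \<longrightarrow> F \<subseteq> BE \<longrightarrow> (\<Sum>(x, r)\<in>F. r powr 1) \<le> 2 powr 1 * (b + 1)"
    by auto
  have rm: "\<forall>b\<in>BW \<union> BE. 0 < snd b \<and> snd b \<le> (1 / 2) ^ Suc m"
  proof
    fix b assume b: "b \<in> BW \<union> BE"
    have "(1 / 2 :: real) ^ Suc (max m (P (fst b))) \<le> (1 / 2) ^ Suc m"
      by (intro power_decreasing) auto
    moreover have "0 < snd b \<and> snd b \<le> (1 / 2) ^ Suc (max m (P (fst b)))" if "b \<in> BW"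
      using bspec[OF BW(1) that] by (simp add: case_prod_unfold)
    moreover have "0 < snd b \<and> snd b \<le> (1 / 2) ^ Suc m" if "b \<in> BE"
      using bspec[OF BE(1) that] by (simp add: case_prod_unfold)
    ultimately show "0 < snd b \<and> snd b \<le> (1 / 2) ^ Suc m"
      using b by (meson UnE order_trans)
  qed
  have "K \<subseteq> (\<Union>(x, r)\<in>BW \<union> BE. ball x r)" using K(3) BW(2) BE(2) by blast
  from cover_by_nbrs[OF K(1) this rm]
  obtain F p where F: "finite F" "F \<subseteq> BW \<union> BE" "K \<subseteq> (\<Union>e\<in>(\<Union>b\<in>F. nbrs (p b) (fst b)). cube_set e)"
    and p0: "\<forall>b\<in>BW \<union> BE. snd b \<le> (1 / 2) ^ p b \<and> (1 / 2) ^ p b < 2 * snd b"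
    by (elim exE conjE) (rule that)
  define I where "I = (\<Union>b\<in>F. nbrs (p b) (fst b))"
  have finI: "finite I" using F(1) finite_nbrs by (auto simp: I_def)
  have pm: "m \<le> p b" if "b \<in> BW \<union> BE" for b
    using rm p0 that dyadic_level_gt[of "p b" "snd b" m] less_imp_le by blast
  have Ilev: "m \<le> fst e" if "e \<in> I" for e
    
  proof -
    from that obtain b where b: "b \<in> F" "e \<in> nbrs (p b) (fst b)" by (auto simp: I_def)
    then show ?thesis using pm[of b] F(2) fst_nbrs[OF b(2)] by auto
  qed
  obtain T where T: "finite T" "\<forall>t\<in>T. m \<le> fst t" "K \<subseteq> (\<Union>t\<in>T. cube_set t)"
    "(\<Sum>t\<in>T. (1 / 2) ^ fst t) \<le> (\<Sum>e\<in>I. w e)"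
    using amplification[OF K(2) _ J finI F(3)[folded I_def] Ilev] esc
    unfolding w_def g_def by (auto simp: m_def)
  note T(4)
  also have "(\<Sum>e\<in>I. w e) \<le> (\<Sum>b\<in>F. \<Sum>e\<in>nbrs (p b) (fst b). w e)"
    unfolding I_def using F(1) finite_nbrs w0 by (intro sum_UN_le) auto
  also have "\<dots> = (\<Sum>b\<in>F \<inter> BW. \<Sum>e\<in>nbrs (p b) (fst b). w e) + (\<Sum>b\<in>F - BW. \<Sum>e\<in>nbrs (p b) (fst b). w e)"
    using F(1) by (subst sum.union_disjoint[symmetric]) (auto intro: sum.cong)
  also have "(\<Sum>b\<in>F \<inter> BW. \<Sum>e\<in>nbrs (p b) (fst b). w e) \<le> (\<Sum>b\<in>F \<inter> BW. 3 ^ CARD('n) * (C' * snd b powr s))"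
  proof (intro sum_mono sum_nbrs_le)
    fix b e assume be: "b \<in> F \<inter> BW" "e \<in> nbrs (p b) (fst b)"
    then have r: "0 < snd b" "snd b \<le> (1 / 2) ^ Suc (max m (P (fst b)))" "fst b \<in> W"
      using BW(1) by auto
    have pb: "(1 / 2) ^ p b < 2 * snd b" using p0 be by blast
    then have "P (fst b) \<le> p b" using dyadic_level_gt[OF pb r(2)] by simp
    then have "w e \<le> C * ((1 / 2) ^ p b) powr s" using P r(3) be(2) by blast
    also have "\<dots> \<le> max C 1 * (2 * snd b) powr s"
      using pb W(2) by (intro mult_mono powr_mono2) auto
    also have "\<dots> = C' * snd b powr s" using r(1) by (simp add: C'_def powr_mult)
    finally show "w e \<le> C' * snd b powr s" .
  qed
  also have "(\<Sum>b\<in>F \<inter> BW. 3 ^ CARD('n) * (C' * snd b powr s)) = 3 ^ CARD('n) * C' * (\<Sum>(x, r)\<in>F \<inter> BW. r powr s)"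
    unfolding sum_distrib_left by (intro sum.cong) (auto simp: mult_ac)
  also have "\<dots> \<le> 3 ^ CARD('n) * C' * \<eta>"
    using BW(3) F(1) C' by (intro mult_left_mono) auto
  also have "\<dots> = 1" using C' by (simp add: \<eta>_def)
  also have "(\<Sum>b\<in>F - BW. \<Sum>e\<in>nbrs (p b) (fst b). w e) \<le> (\<Sum>b\<in>F - BW. 3 ^ CARD('n) * (2 * snd b powr 1))"
  proof (intro sum_mono sum_nbrs_le)
    fix b e assume be: "b \<in> F - BW" "e \<in> nbrs (p b) (fst b)"
    then have bE: "b \<in> BW \<union> BE" using F(2) by blast
    \<comment> \<open>Nothing is known about scales near \<open>E\<close>, but
      \<open>g \<ge> 1\<close> still bounds the weight by the side.\<close>
    have "w e \<le> (1 / 2) ^ fst e"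
      using g by (simp add: w_def weight_def divide_le_eq_1 field_simps)
    also have "\<dots> = (1 / 2) ^ p b" using fst_nbrs[OF be(2)] by simp
    also have "\<dots> \<le> 2 * snd b powr 1"
      using bspec[OF p0 bE] bspec[OF rm bE] by simp
    finally show "w e \<le> 2 * snd b powr 1" .
  qed
  also have "(\<Sum>b\<in>F - BW. 3 ^ CARD('n) * (2 * snd b powr 1)) = 3 ^ CARD('n) * 2 * (\<Sum>(x, r)\<in>F - BW. r powr 1)"
    unfolding sum_distrib_left by (intro sum.cong) (auto simp: mult_ac)
  also have "\<dots> \<le> 3 ^ CARD('n) * 2 * (2 powr 1 * (b + 1))"
    using BE(3) F(1,2) by (intro mult_left_mono) auto
  finally have "(\<Sum>t\<in>T. (1 / 2) ^ fst t) \<le> B" by (simp add: B_def algebra_simps)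
  then show False using long[of T] T by simp
qed

subsection \<open>From non-porosity to good cubes\<close>

lemma card_le_spread:
  fixes N :: "nat set" and a :: real
  assumes "finite N" "\<And>n n'. n \<in> N \<Longrightarrow> n' \<in> N \<Longrightarrow> real n' - real n \<le> a" "0 \<le> a"
  shows "real (card N) \<le> a + 1"
proof (cases "N = {}")
  case False
  have "N \<subseteq> {Min N..Min N + nat \<lfloor>a\<rfloor>}"
  proof
    fix n assume n: "n \<in> N"
    then have "real n - real (Min N) \<le> a" using assms False by simp
    then have "int n - int (Min N) \<le> \<lfloor>a\<rfloor>" by linarith
    then show "n \<in> {Min N..Min N + nat \<lfloor>a\<rfloor>}" using n assms(1) by auto
  qed
  then have "card N \<le> card {Min N..Min N + nat \<lfloor>a\<rfloor>}" by (intro card_mono) auto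
  also have "\<dots> = nat \<lfloor>a\<rfloor> + 1" by simp
  finally show ?thesis using assms(3) by linarith
qed (use assms in simp)

text \<open>The dyadic level of a cube that has a definite size relative to the scale lam ^ n, when
  2 powr (- \<theta>) = lam.\<close>
definition level_of :: "real \<Rightarrow> nat \<Rightarrow> nat \<Rightarrow> nat" where
  "level_of \<theta> D n = nat \<lceil>\<theta> * real n\<rceil> + D"

lemma level_of_bounds:
  assumes "0 < \<theta>"
  shows "\<theta> * real n + real D \<le> real (level_of \<theta> D n)" "real (level_of \<theta> D n) < \<theta> * real n + real D + 1"
proof -
  have "0 \<le> \<theta> * real n" using assms by simp
  then show "\<theta> * real n + real D \<le> real (level_of \<theta> D n)" "real (level_of \<theta> D n) < \<theta> * real n + real D + 1"
    unfolding level_of_def by linarith+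
qed

text \<open>The offset \<open>D\<close> makes the cube so small that a ball of radius
  \<open>lam ^ n\<close> has room for it and its surroundings; rounding to an integer level costs
  the second factor 2.\<close>

lemma half_power_level_of:
  assumes "0 < \<theta>" and lam: "lam = 2 powr (- \<theta>)"
  shows "2 ^ D * (1 / 2) ^ level_of \<theta> D n \<le> lam ^ n"
    and "lam ^ n \<le> 2 ^ Suc D * (1 / 2 :: real) ^ level_of \<theta> D n"
proof -
  have 1: "lam ^ n = 2 powr (- \<theta> * real n)"
    by (simp add: lam powr_powr flip: powr_realpow)
  have 2: "2 ^ k * (1 / 2) ^ level_of \<theta> D n = 2 powr (real k - real (level_of \<theta> D n))" for k
    by (simp add: powr_diff powr_realpow power_one_over)
  show "2 ^ D * (1 / 2) ^ level_of \<theta> D n \<le> lam ^ n"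
    unfolding 1 2 using level_of_bounds[OF assms(1), where n = n and D = D] by simp
  show "lam ^ n \<le> 2 ^ Suc D * (1 / 2 :: real) ^ level_of \<theta> D n"
    unfolding 1 2 using level_of_bounds[OF assms(1), where n = n and D = D] by simp
qed

lemma card_level_window:
  assumes "0 < \<theta>" "finite N"
  shows "real (card {n \<in> N. j \<le> level_of \<theta> D n \<and> level_of \<theta> D n < j + J}) \<le> real J / \<theta> + 1"
proof (rule card_le_spread)
  fix n n' assume "n \<in> {n \<in> N. j \<le> level_of \<theta> D n \<and> level_of \<theta> D n < j + J}"
    "n' \<in> {n \<in> N. j \<le> level_of \<theta> D n \<and> level_of \<theta> D n < j + J}"
  \<comment> \<open>Integrality gives the \<open>+ 1\<close>, which cancels the rounding error of
    \<open>level_of\<close>.\<close>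
  then have "real (level_of \<theta> D n') + 1 \<le> real j + real J" "real j \<le> real (level_of \<theta> D n)" by auto
  then have "\<theta> * real n' - \<theta> * real n \<le> real J"
    using level_of_bounds[OF assms(1), where n = n and D = D] level_of_bounds[OF assms(1), where n = n' and D = D] by linarith
  then show "real n' - real n \<le> real J / \<theta>" using assms by (simp add: field_simps)
qed (use assms in auto)

text \<open>Non-porosity forbids a hole around the centre of \<open>Q\<close>, so \<open>K\<close>
  comes within \<open>\<epsilon> * r\<close> of it. As \<open>r\<close> is at most 2^(D+1) sides of
  \<open>c\<close>, the exponent \<open>J + D + 3\<close> makes this a quarter of the side of
  \<open>Q\<close>. The 3 in the last hypothesis admits ancestors of cubes in
  \<open>nbrs p z\<close>, which need not contain \<open>z\<close>.\<close>

lemma not_porous_good: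
  fixes K :: "(real ^ 'n::finite) set"
  assumes \<theta>: "0 < \<theta>" "lam = 2 powr (- \<theta>)"
    and D: "4 * real CARD('n) \<le> 2 ^ D" and \<epsilon>: "\<epsilon> \<le> (1 / 2) ^ (J + D + 3)"
    and np: "\<not> porous_at \<epsilon> K z (lam ^ n)"
    and c: "fst c = level_of \<theta> D n" "\<And>x i. x \<in> cube_set c \<Longrightarrow> \<bar>x $ i - z $ i\<bar> \<le> 3 * (1 / 2) ^ fst c"
  shows "good K J c"
  unfolding good_def
proof (intro allI impI)
  fix Q assume Q: "below c Q" "fst Q = fst c + J"
  define r where "r = lam ^ n"
  have r: "2 ^ D * (1 / 2) ^ fst c \<le> r" "r \<le> 2 ^ Suc D * (1 / 2) ^ fst c"
    unfolding r_def c(1) using half_power_level_of[OF \<theta>] by auto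
  have r0: "0 < r" by (simp add: r_def \<theta>)
  have er: "\<epsilon> * r \<le> (1 / 2) ^ fst Q / 4"
  proof -
    have "\<epsilon> * r \<le> (1 / 2) ^ (J + D + 3) * (2 ^ Suc D * (1 / 2) ^ fst c)"
      using r0 r \<epsilon> by (intro mult_mono) auto
    also have "\<dots> = (1 / 2) ^ fst Q / 4" by (simp add: Q power_add power_one_over)
    finally show ?thesis .
  qed
  also have "(1 / 2) ^ fst Q / 4 < (1 / 2 :: real) ^ fst c"
  proof -
    have "(1 / 2 :: real) ^ fst Q \<le> (1 / 2) ^ fst c" unfolding Q by (intro power_decreasing) auto
    moreover have "0 < (1 / 2 :: real) ^ fst Q" by simp
    ultimately show ?thesis by linarith
  qed
  finally have er': "\<epsilon> * r < (1 / 2) ^ fst c" .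
  \<comment> \<open>With d the dimension, 3d sides bound the distance from \<open>z\<close> to the
    centre of \<open>Q\<close>, and one more makes room for the hole; 3d + 1 is at most 4d.\<close>
  have big: "(3 * real CARD('n) + 1) * (1 / 2) ^ fst c \<le> r"
  proof -
    have "(3 * real CARD('n) + 1) * (1 / 2) ^ fst c \<le> 2 ^ D * (1 / 2) ^ fst c"
      using D by (intro mult_right_mono) (auto simp: Suc_leI intro: order_trans[rotated])
    then show ?thesis using r by linarith
  qed
  have "dist z (centre Q) \<le> 3 * real CARD('n) * (1 / 2) ^ fst c"
  proof -
    have "centre Q \<in> cube_set c" using centre_in_cube cube_set_mono[OF Q(1)] by blast
    then have "\<bar>(centre Q - z) $ i\<bar> \<le> 3 * (1 / 2) ^ fst c" for i using c(2) by simp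
    then have "(\<Sum>i\<in>UNIV. \<bar>(centre Q - z) $ i\<bar>) \<le> (\<Sum>i\<in>(UNIV :: 'n set). 3 * (1 / 2) ^ fst c)"
      by (intro sum_mono) auto
    then show ?thesis using norm_le_l1_cart[of "centre Q - z"] by (simp add: dist_norm norm_minus_commute)
  qed
  then have dz: "dist z (centre Q) + (1 / 2) ^ fst c \<le> r" using big by (simp add: algebra_simps)
  then have "centre Q \<in> ball z r"
    using zero_less_power[of "1 / 2 :: real" "fst c"] unfolding mem_ball by linarith
  moreover have "ball (centre Q) (\<epsilon> * r) \<subseteq> ball z r"
  proof
    fix x assume "x \<in> ball (centre Q) (\<epsilon> * r)"
    then show "x \<in> ball z r" using dist_triangle[of z x "centre Q"] dz er' by simp
  qed
  ultimately obtain y where y: "y \<in> K" "dist (centre Q) y < \<epsilon> * r"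
    using np unfolding porous_at_def r_def by (auto simp: subset_iff)
  have "\<bar>y $ i - centre Q $ i\<bar> \<le> (1 / 2) ^ fst Q / 4" for i
    using component_le_norm_cart[of "y - centre Q" i] y(2) er by (simp add: dist_norm norm_minus_commute)
  then show "\<exists>y\<in>K. \<forall>i. \<bar>y $ i - centre Q $ i\<bar> \<le> (1 / 2) ^ fst Q / 4" using y(1) by blast
qed

text \<open>About p/\<theta> scales lie above level p, a share \<kappa> of them good, and a block
  uses up at most \<open>L = J / \<theta> + 1\<close>. Up to a constant this gives
  \<kappa>p/(\<theta>L) blocks, and \<theta>L = J + \<theta> yields the exponent. \<open>C\<close>
  is chosen before \<open>z\<close>; the threshold \<open>M\<close> affects only
  \<open>P\<close>.\<close>

lemma weight_decay:
  fixes K :: "(real ^ 'n::finite) set"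
  assumes \<theta>: "0 < \<theta>" "lam = 2 powr (- \<theta>)"
    and D: "4 * real CARD('n) \<le> 2 ^ D" and \<epsilon>: "\<epsilon> \<le> (1 / 2) ^ (J + D + 3)"
    and J: "0 < J" and g: "1 \<le> g" and \<kappa>: "0 < \<kappa>" "\<kappa> \<le> 1"
  shows "\<exists>C. \<forall>z. (\<exists>M. \<forall>n\<ge>M. \<kappa> * real n \<le> real (card {k. 0 < k \<and> k < n \<and> \<not> porous_at \<epsilon> K z (lam ^ k)})) \<longrightarrow>
    (\<exists>P. \<forall>p\<ge>P. \<forall>e\<in>nbrs p z. weight g (good K J) J m e \<le>
        C * ((1 / 2) ^ p) powr (1 + \<kappa> * (log 2 g / (real J + \<theta>))))"
proof -
  define L where "L = real J / \<theta> + 1"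
  have L: "0 < L" "\<theta> * L = real J + \<theta>" using \<theta> by (auto simp: L_def field_simps add_pos_nonneg)
  \<comment> \<open>The scales lost: the finest ones, whose blocks do not fit above level p; one for
    the floor in \<open>n1\<close>; and at most \<open>m / \<theta> + 1\<close> above the starting
    level.\<close>
  define c0 where "c0 = \<kappa> * (real J + real D + 1) / \<theta> + \<kappa> + real m / \<theta> + 1"
  define C where "C = g powr (c0 / L)"
  have key: "weight g (good K J) J m e \<le> C * ((1 / 2) ^ p) powr (1 + \<kappa> * (log 2 g / (real J + \<theta>)))"
    if M: "\<And>n. n \<ge> M \<Longrightarrow> \<kappa> * real n \<le> real (card {k. 0 < k \<and> k < n \<and> \<not> porous_at \<epsilon> K z (lam ^ k)})"
      and p: "real p \<ge> \<theta> * (real M + 1) + real J + real D + 1" and e: "e \<in> nbrs p z" for z M p e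
  proof -
    have fe: "fst e = p" using e by (rule fst_nbrs)
    \<comment> \<open>For n up to \<open>y\<close>, a block starting at the level of n still fits
      above \<open>e\<close>.\<close>
    define y where "y = (real p - real J - real D - 1) / \<theta>"
    have y: "real M + 1 \<le> y" using p \<theta>(1) by (simp add: y_def field_simps)
    define n1 where "n1 = nat \<lfloor>y\<rfloor>"
    have n1: "real n1 \<le> y" "y < real n1 + 1" "M \<le> n1" using y unfolding n1_def by linarith+
    define N where "N = {k. 0 < k \<and> k < n1 \<and> \<not> porous_at \<epsilon> K z (lam ^ k)}"
    have finN: "finite N" by (simp add: N_def)
    have "real (card {n \<in> N. m \<le> level_of \<theta> D n \<and> level_of \<theta> D n + J \<le> fst e})
        \<le> L * real (steps (good K J) J m e)"
      unfolding L_def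
    proof (rule card_good_levels_le_steps[OF finN J card_level_window[OF \<theta>(1) finN]])
      fix n assume n: "n \<in> N" "level_of \<theta> D n \<le> fst e"
      show "good K J (anc (level_of \<theta> D n) e)"
      proof (rule not_porous_good[OF \<theta> D \<epsilon>])
        show "\<not> porous_at \<epsilon> K z (lam ^ n)" using n by (simp add: N_def)
        fix x i assume x: "x \<in> cube_set (anc (level_of \<theta> D n) e)"
        have ce: "centre e \<in> cube_set (anc (level_of \<theta> D n) e)"
          using centre_in_cube cube_set_mono[OF below_anc[OF n(2)]] by blast
        have "\<bar>x $ i - centre e $ i\<bar> \<le> (1 / 2) ^ level_of \<theta> D n"
          using cube_coord_diff[OF x ce] by simp
        moreover have "\<bar>centre e $ i - z $ i\<bar> \<le> 2 * (1 / 2) ^ p"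
          by (rule nbrs_coord_diff[OF e centre_in_cube])
        moreover have "(1 / 2 :: real) ^ p \<le> (1 / 2) ^ level_of \<theta> D n"
          using n(2) fe by (intro power_decreasing) auto
        ultimately show "\<bar>x $ i - z $ i\<bar> \<le> 3 * (1 / 2) ^ fst (anc (level_of \<theta> D n) e)"
          unfolding fst_anc by linarith
      qed simp
    qed
    moreover have "real (card N) \<le> real (card {n \<in> N. m \<le> level_of \<theta> D n \<and> level_of \<theta> D n + J \<le> fst e}) + (real m / \<theta> + 1)"
    proof -
      have low: "level_of \<theta> D n + J \<le> fst e" if "n \<in> N" for n
      proof -
        have "real n \<le> y" using that n1 by (auto simp: N_def)
        then have "\<theta> * real n \<le> real p - real J - real D - 1" using \<theta>(1) by (simp add: y_def field_simps)
        then show ?thesis using level_of_bounds[OF \<theta>(1), where n = n and D = D] fe by linarith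
      qed
      have "N = {n \<in> N. m \<le> level_of \<theta> D n \<and> level_of \<theta> D n + J \<le> fst e} \<union> {n \<in> N. 0 \<le> level_of \<theta> D n \<and> level_of \<theta> D n < 0 + m}"
        using low by auto
      then have "card N \<le> card {n \<in> N. m \<le> level_of \<theta> D n \<and> level_of \<theta> D n + J \<le> fst e}
          + card {n \<in> N. 0 \<le> level_of \<theta> D n \<and> level_of \<theta> D n < 0 + m}"
        by (metis (lifting) card_Un_le)
      then show ?thesis using card_level_window[OF \<theta>(1) finN, of 0 D m] by linarith
    qed
    moreover have "\<kappa> * real n1 \<le> real (card N)" using M n1(3) by (simp add: N_def)
    moreover have "\<kappa> * (y - 1) \<le> \<kappa> * real n1" using n1 \<kappa> by (intro mult_left_mono) auto
    moreover have "\<kappa> * (y - 1) = \<kappa> * real p / \<theta> - (c0 - real m / \<theta> - 1)"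
      by (simp add: y_def c0_def diff_divide_distrib add_divide_distrib algebra_simps)
    ultimately have "\<kappa> * real p / \<theta> - c0 \<le> L * real (steps (good K J) J m e)" by linarith
    then have st: "(\<kappa> * real p / \<theta> - c0) / L \<le> real (steps (good K J) J m e)"
      using L by (simp add: field_simps)
    define a where "a = \<kappa> * (log 2 g / (real J + \<theta>))"
    have "g powr ((\<kappa> * real p / \<theta>) / L) = 2 powr (real p * a)"
    proof -
      have "g = 2 powr (log 2 g)" using g by simp
      then have "g powr ((\<kappa> * real p / \<theta>) / L) = 2 powr (log 2 g * ((\<kappa> * real p / \<theta>) / L))"
        by (metis powr_powr)
      also have "log 2 g * ((\<kappa> * real p / \<theta>) / L) = real p * a"
        unfolding a_def L(2)[symmetric] by simp
      finally show ?thesis .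
    qed
    then have "2 powr (real p * a) / C = g powr ((\<kappa> * real p / \<theta> - c0) / L)"
      by (simp add: C_def powr_diff diff_divide_distrib)
    also have "\<dots> \<le> g powr real (steps (good K J) J m e)" using st g by (intro powr_mono) auto
    also have "\<dots> = g ^ steps (good K J) J m e" using g by (simp add: powr_realpow)
    finally have le: "2 powr (real p * a) / C \<le> g ^ steps (good K J) J m e" .
    have "0 < C" using g by (simp add: C_def)
    have "weight g (good K J) J m e \<le> (1 / 2) ^ p / (2 powr (real p * a) / C)"
      unfolding weight_def fe using le \<open>0 < C\<close> by (intro divide_left_mono mult_pos_pos) (use g in auto)
    also have "\<dots> = C * ((1 / 2) ^ p * 2 powr (- (real p * a)))" by (simp add: powr_minus field_simps)
    also have "(1 / 2) ^ p * 2 powr (- (real p * a)) = ((1 / 2) ^ p) powr (1 + a)"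
    proof -
      have "(1 / 2 :: real) ^ p = 2 powr (- real p)"
        by (simp add: powr_minus powr_realpow power_one_over inverse_eq_divide)
      then have "((1 / 2 :: real) ^ p) powr (1 + a) = 2 powr (- real p * (1 + a))"
        by (simp add: powr_powr)
      also have "\<dots> = 2 powr (- real p) * 2 powr (- (real p * a))"
        by (simp add: algebra_simps flip: powr_add)
      finally show ?thesis using \<open>(1 / 2 :: real) ^ p = 2 powr (- real p)\<close> by simp
    qed
    finally show ?thesis by (simp add: a_def)
  qed
  show ?thesis
  proof (intro exI[of _ C] allI impI)
    fix z assume "\<exists>M. \<forall>n\<ge>M. \<kappa> * real n \<le> real (card {k. 0 < k \<and> k < n \<and> \<not> porous_at \<epsilon> K z (lam ^ k)})"
    then obtain M where M: "\<And>n. n \<ge> M \<Longrightarrow> \<kappa> * real n \<le> real (card {k. 0 < k \<and> k < n \<and> \<not> porous_at \<epsilon> K z (lam ^ k)})"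
      by blast
    obtain P :: nat where "\<theta> * (real M + 1) + real J + real D + 1 \<le> real P" using real_arch_simple by blast
    then have "\<theta> * (real M + 1) + real J + real D + 1 \<le> real p" if "P \<le> p" for p using that by linarith
    then show "\<exists>P. \<forall>p\<ge>P. \<forall>e\<in>nbrs p z. weight g (good K J) J m e \<le>
        C * ((1 / 2) ^ p) powr (1 + \<kappa> * (log 2 g / (real J + \<theta>)))"
      using key[OF M] by blast
  qed
qed

text \<open>Otherwise all non-porous scales would have levels below \<open>m\<close>; at most
  \<open>m / \<theta> + 1\<close> scales do, against the linear growth of their number.\<close>

lemma not_porous_infinitely_good:
  fixes K :: "(real ^ 'n::finite) set"
  assumes \<theta>: "0 < \<theta>" "lam = 2 powr (- \<theta>)"
    and D: "4 * real CARD('n) \<le> 2 ^ D" and \<epsilon>: "\<epsilon> \<le> (1 / 2) ^ (J + D + 3)"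
    and \<kappa>: "0 < \<kappa>"
    and M: "\<And>n. n \<ge> M \<Longrightarrow> \<kappa> * real n \<le> real (card {k. 0 < k \<and> k < n \<and> \<not> porous_at \<epsilon> K z (lam ^ k)})"
  shows "\<exists>j\<ge>m. good K J (cell j z)"
proof (rule ccontr)
  assume none: "\<not> ?thesis"
  have low: "level_of \<theta> D k < 0 + m" if "\<not> porous_at \<epsilon> K z (lam ^ k)" for k
  proof (rule ccontr)
    assume "\<not> level_of \<theta> D k < 0 + m"
    moreover have "good K J (cell (level_of \<theta> D k) z)"
    proof (rule not_porous_good[OF \<theta> D \<epsilon> that])
      fix x i assume "x \<in> cube_set (cell (level_of \<theta> D k) z)"
      then have "\<bar>x $ i - z $ i\<bar> \<le> (1 / 2) ^ level_of \<theta> D k"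
        using cube_coord_diff[OF _ mem_cube_set_cell] by fastforce
      moreover have "(0 :: real) \<le> (1 / 2) ^ level_of \<theta> D k" by simp
      ultimately show "\<bar>x $ i - z $ i\<bar> \<le> 3 * (1 / 2) ^ fst (cell (level_of \<theta> D k) z)"
        unfolding fst_cell by linarith
    qed simp
    ultimately show False using none by auto
  qed
  obtain n :: nat where n: "(real m / \<theta> + 2) / \<kappa> \<le> real n" using real_arch_simple by blast
  define n' where "n' = max n M"
  define N where "N = {k. 0 < k \<and> k < n' \<and> \<not> porous_at \<epsilon> K z (lam ^ k)}"
  have fN: "finite N" by (simp add: N_def)
  have "N = {k\<in>N. 0 \<le> level_of \<theta> D k \<and> level_of \<theta> D k < 0 + m}" using low by (auto simp: N_def)
  then have "real (card N) \<le> real m / \<theta> + 1" using card_level_window[OF \<theta>(1) fN, of 0 D m] by metis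
  moreover have "\<kappa> * real n' \<le> real (card N)" using M[of n'] by (simp add: N_def n'_def)
  moreover have "real m / \<theta> + 2 \<le> \<kappa> * real n" using n \<kappa> by (simp add: field_simps)
  moreover have "\<kappa> * real n \<le> \<kappa> * real n'" using \<kappa> by (simp add: n'_def)
  ultimately show False by linarith
qed

section \<open>Nontriviality of the continuum, and the density condition as a count\<close>

lemma two_points_if_hausdorff_measure_pos:
  fixes K :: "'a::metric_space set"
  assumes "hausdorff_measure 1 K > 0"
  shows "\<exists>x\<in>K. \<exists>y\<in>K. x \<noteq> y"
proof (rule ccontr)
  assume "\<not> ?thesis"
  then obtain a where a: "K \<subseteq> {a}" by blast
  have "hausdorff_premeasure 1 \<delta> K \<le> 0" if "0 < \<delta>" for \<delta>
  proof -
    have "hausdorff_premeasure 1 \<delta> K \<le> (\<Sum>i::nat. diam_pow 1 {a})"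
      using a that by (intro hausdorff_premeasure_le) auto
    then show ?thesis by (simp add: diam_pow_def)
  qed
  then have "hausdorff_measure 1 K = 0"
    unfolding hausdorff_measure_def by (metis SUP_least greaterThan_iff le_zero_eq)
  then show False using assms by simp
qed

lemma not_subset_small_cube:
  fixes K :: "(real ^ 'n::finite) set"
  assumes "x \<in> K" "y \<in> K" "x \<noteq> y"
  shows "\<exists>m. \<forall>Q. m \<le> fst Q \<longrightarrow> \<not> K \<subseteq> cube_set Q"
proof -
  obtain i where i: "x $ i \<noteq> y $ i" using assms by (auto simp: vec_eq_iff)
  obtain m where m: "(1 / 2) ^ m < \<bar>x $ i - y $ i\<bar>"
    using real_arch_pow_inv[of "\<bar>x $ i - y $ i\<bar>" "1 / 2"] i by auto
  have "\<not> K \<subseteq> cube_set Q" if "m \<le> fst Q" for Q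
  proof
    assume "K \<subseteq> cube_set Q"
    then have "\<bar>x $ i - y $ i\<bar> \<le> (1 / 2) ^ fst Q" using assms cube_coord_diff by blast
    also have "\<dots> \<le> (1 / 2) ^ m" using that by (intro power_decreasing) auto
    finally show False using m by simp
  qed
  then show ?thesis by blast
qed

text \<open>A liminf of at least \<open>\<kappa>\<close> gives an eventual bound only for smaller
  \<open>\<kappa>'\<close>. The loss is harmless, as the theorem is proved by refuting a strict
  inequality.\<close>

lemma not_porous_with_density_card:
  assumes "not_porous_with_density lam \<epsilon> \<kappa> K z" "\<kappa>' < \<kappa>"
  shows "\<exists>M. \<forall>n\<ge>M. \<kappa>' * real n \<le> real (card {k. 0 < k \<and> k < n \<and> \<not> porous_at \<epsilon> K z (lam ^ k)})"
proof -
  have "ereal \<kappa>' < liminf (\<lambda>m::nat.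
       ereal (real (card {n::nat. 0 < n \<and> n < m \<and> \<not> porous_at \<epsilon> K z (lam ^ n)}) / real m))"
    using assms unfolding not_porous_with_density_def by (meson ereal_less(2) less_le_trans less_ereal.simps(1))
  then have "\<forall>\<^sub>F m in sequentially.
      ereal \<kappa>' < ereal (real (card {n::nat. 0 < n \<and> n < m \<and> \<not> porous_at \<epsilon> K z (lam ^ n)}) / real m)"
    by (rule less_LiminfD)
  then obtain M where M: "\<And>m. m \<ge> M \<Longrightarrow>
      \<kappa>' < real (card {n::nat. 0 < n \<and> n < m \<and> \<not> porous_at \<epsilon> K z (lam ^ n)}) / real m"
    unfolding eventually_sequentially by auto
  have "\<kappa>' * real n \<le> real (card {k. 0 < k \<and> k < n \<and> \<not> porous_at \<epsilon> K z (lam ^ k)})" if "n \<ge> M" for n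
  proof (cases "n = 0")
    case False
    then show ?thesis using M[OF that] by (simp add: field_simps)
  qed simp
  then show ?thesis by blast
qed

theorem theorem5:
  fixes lam :: real
  assumes "CARD('n::finite) \<ge> 2"
    and "0 < lam" and "lam < 1"
  shows "\<exists>C>0. \<forall>(K :: (real ^ 'n) set) W E \<epsilon> \<kappa>.
           compact K \<and> connected K \<and> K = W \<union> E
           \<and> hausdorff_measure 1 W > 0 \<and> hausdorff_measure 1 E < \<infinity>
           \<and> 0 < \<epsilon> \<and> \<epsilon> < 1 \<and> 0 < \<kappa> \<and> \<kappa> < 1
           \<and> (\<forall>z\<in>W. not_porous_with_density lam \<epsilon> \<kappa> K z)
           \<longrightarrow> hausdorff_dim K
                 \<ge> ereal (1 + \<kappa> * (real CARD('n) - 1 - C / \<bar>ln \<epsilon>\<bar>))"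
proof -
  define d where "d = real CARD('n) - 1"
  have d: "1 \<le> d" using assms(1) by (simp add: d_def)
  define \<theta> where "\<theta> = - log 2 lam"
  have \<theta>: "0 < \<theta>" "lam = 2 powr (- \<theta>)" using assms by (auto simp: \<theta>_def)
  obtain D where "4 * real CARD('n) < 2 ^ D" using real_arch_pow[of 2 "4 * real CARD('n)"] by auto
  then have D: "4 * real CARD('n) \<le> 2 ^ D" by simp
  \<comment> \<open>Two demands: \<open>d * (real D + 7)\<close> makes a nontrivial bound force
    \<epsilon> so small that \<open>J \<ge> 4\<close> and \<open>J \<ge> l / 2\<close>, and
    \<open>3 + d * \<theta>\<close> is the numerator of the deficit \<open>d - q\<close>. In
    \<open>C\<close>, the 2 comes from \<open>J \<ge> l / 2\<close> and \<open>ln 2\<close> from the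
    change of base.\<close>
  define A where "A = d * (real D + 7) + (3 + d * \<theta>)"
  define C where "C = 2 * ln 2 * A"
  have dt: "0 < 3 + d * \<theta>" using d \<theta> by (simp add: add_pos_pos)
  have A: "0 < A" "d * (real D + 7) \<le> A" "3 + d * \<theta> \<le> A"
    unfolding A_def using d dt by (auto simp: add_nonneg_pos)
  have C: "0 < C" using A by (simp add: C_def)
  have main: "ereal (1 + \<kappa> * (real CARD('n) - 1 - C / \<bar>ln \<epsilon>\<bar>)) \<le> hausdorff_dim K"
    if K: "compact K" "connected K" "K = W \<union> E"
      and W: "hausdorff_measure 1 W > 0" and E: "hausdorff_measure 1 E < \<infinity>"
      and \<epsilon>: "0 < \<epsilon>" "\<epsilon> < 1" and \<kappa>: "0 < \<kappa>" "\<kappa> < 1"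
      and np: "\<forall>z\<in>W. not_porous_with_density lam \<epsilon> \<kappa> K z"
    for K :: "(real ^ 'n) set" and W E \<epsilon> \<kappa>
    unfolding hausdorff_dim_def
  proof (rule INF_greatest)
    fix s assume "s \<in> {s. 0 \<le> s \<and> hausdorff_measure s K = 0}"
    then have s: "0 \<le> s" "hausdorff_measure s K = 0" by auto
    show "ereal (1 + \<kappa> * (real CARD('n) - 1 - C / \<bar>ln \<epsilon>\<bar>)) \<le> ereal s"
    proof (rule ccontr)
      assume "\<not> ?thesis"
      then have lt: "s < 1 + \<kappa> * (d - C / \<bar>ln \<epsilon>\<bar>)" by (simp add: d_def)
      have HK: "0 < hausdorff_measure 1 K"
        using W hausdorff_measure_mono[of W K 1] K(3) by (auto intro: less_le_trans)
      have s1: "1 < s" using HK hausdorff_measure_0_mono[OF s(2,1), of 1] by (metis less_irrefl not_le)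
      define l where "l = - log 2 \<epsilon>"
      have l: "\<bar>ln \<epsilon>\<bar> = l * ln 2" "0 < l" "\<epsilon> = 2 powr (- l)"
      proof -
        show "\<bar>ln \<epsilon>\<bar> = l * ln 2" using \<epsilon> by (simp add: l_def log_def)
        show "0 < l" "\<epsilon> = 2 powr (- l)" using \<epsilon> by (simp_all add: l_def)
      qed
      have Cl: "C / \<bar>ln \<epsilon>\<bar> = 2 * A / l" using l by (simp add: C_def)
      \<comment> \<open>As \<open>s > 1\<close>, the claimed bound exceeds 1, and this alone makes
        \<epsilon> small.\<close>
      have "0 < \<kappa> * (d - 2 * A / l)" using lt s1 unfolding Cl by linarith
      then have "2 * A / l < d" using \<kappa> by (simp add: zero_less_mult_iff)
      then have "2 * A < d * l" using l by (simp add: field_simps)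
      then have "d * (2 * (real D + 7)) < d * l" using A(2) by (simp add: algebra_simps)
      then have lD: "2 * (real D + 7) < l" using d by simp
      define N where "N = nat \<lfloor>l\<rfloor>"
      have fl: "real N \<le> l" "l < real N + 1"
        using l(2) unfolding N_def by linarith+
      \<comment> \<open>The largest \<open>J\<close> that \<open>not_porous_good\<close> allows for
        this \<epsilon>.\<close>
      define J where "J = N - (D + 3)"
      have "real D + 3 < real N" using lD fl of_nat_0_le_iff[of D, where 'a = real] by argo
      then have JD: "real J = real N - (real D + 3)" by (simp add: J_def of_nat_diff)
      then have J: "real (J + D + 3) \<le> l" "l / 2 \<le> real J" "4 \<le> J"
        using lD fl by (auto simp flip: of_nat_le_iff[where 'a = real])
      have \<epsilon>J: "\<epsilon> \<le> (1 / 2) ^ (J + D + 3)"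
      proof -
        have "\<epsilon> \<le> 2 powr (- real (J + D + 3))" unfolding l(3) using J(1) by (intro powr_mono) auto
        also have "\<dots> = (1 / 2) ^ (J + D + 3)"
          unfolding powr_minus powr_realpow[OF zero_less_numeral] by (simp add: power_one_over inverse_eq_divide)
        finally show ?thesis .
      qed
      define g :: real where "g = 2 ^ ((CARD('n) - 1) * J) / 8"
      have "1 * 4 \<le> (CARD('n) - 1) * J" using assms(1) J(3) by (intro mult_le_mono) auto
      then have "(2 :: real) ^ 4 \<le> 2 ^ ((CARD('n) - 1) * J)" by (intro power_increasing) auto
      then have g16: "(16 :: real) \<le> 2 ^ ((CARD('n) - 1) * J)" by simp
      then have g1: "1 \<le> g" by (simp add: g_def)
      have dn: "real (CARD('n) - 1) = d" using assms(1) by (simp add: d_def of_nat_diff)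
      have "log 2 (8 :: real) = 3" using log_pow_cancel[of 2 3] by simp
      then have "log 2 g = log 2 (2 ^ ((CARD('n) - 1) * J)) - 3"
        unfolding g_def by (subst log_divide) auto
      also have "\<dots> = real ((CARD('n) - 1) * J) - 3" by (subst log_pow_cancel) auto
      also have "\<dots> = d * real J - 3" using dn by simp
      finally have lg: "log 2 g = d * real J - 3" .
      define q where "q = log 2 g / (real J + \<theta>)"
      have Jt: "0 < real J + \<theta>" using \<theta> by simp
      have "d - q = (3 + d * \<theta>) / (real J + \<theta>)"
        unfolding q_def lg using Jt by (simp add: field_simps)
      also have "\<dots> \<le> A / (l / 2)"
        using A dt J(2) l(2) \<theta>(1) by (intro frac_le) auto
      finally have "d - C / \<bar>ln \<epsilon>\<bar> \<le> q" unfolding Cl by simp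
      then have "\<kappa> * (d - C / \<bar>ln \<epsilon>\<bar>) \<le> \<kappa> * q" using \<kappa> by (intro mult_left_mono) auto
      then have sq: "s - 1 < \<kappa> * q" using lt by linarith
      then have "0 < \<kappa> * q" using s1 by linarith
      then have q: "0 < q" using \<kappa> by (simp add: zero_less_mult_iff)
      \<comment> \<open>Chosen so that the exponent in \<open>weight_decay\<close> is exactly
        \<open>s\<close>; it is below \<open>\<kappa>\<close> because \<open>s\<close> lies strictly
        below the bound.\<close>
      define \<kappa>' where "\<kappa>' = (s - 1) / q"
      have \<kappa>': "0 < \<kappa>'" "\<kappa>' < \<kappa>" "s = 1 + \<kappa>' * q"
        using q s1 sq by (auto simp: \<kappa>'_def field_simps)
      have dens: "\<exists>M. \<forall>n\<ge>M. \<kappa>' * real n \<le> real (card {k. 0 < k \<and> k < n \<and> \<not> porous_at \<epsilon> K z (lam ^ k)})"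
        if "z \<in> W" for z
        using not_porous_with_density_card[OF _ \<kappa>'(2)] np that by blast
      obtain m0 where esc: "\<And>Q. m0 \<le> fst Q \<Longrightarrow> \<not> K \<subseteq> cube_set Q"
        using two_points_if_hausdorff_measure_pos[OF HK] not_subset_small_cube by blast
      show False
      proof (cases "hausdorff_measure 1 K = \<infinity>")
        case True
        have W0: "hausdorff_measure s W = 0"
          using s(2) hausdorff_measure_mono[of W K s] K(3) by auto
        show False
        proof (rule infinite_length_contradiction[OF K E True W0 _ esc])
          show "0 < s" "0 < J" using s1 J by auto
          show "1 \<le> 2 ^ ((CARD('n) - 1) * J) / (8 :: real)" using g1 by (simp add: g_def)
          show "\<exists>C. \<forall>z\<in>W. \<exists>P. \<forall>p\<ge>P. \<forall>e\<in>nbrs p z.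
              weight (2 ^ ((CARD('n) - 1) * J) / 8) (good K J) J m e \<le> C * ((1 / 2) ^ p) powr s" for m
            unfolding g_def[symmetric]
          proof -
            have "0 < J" "\<kappa>' \<le> 1" using J(3) \<kappa>'(2) \<kappa>(2) by auto
            from weight_decay[OF \<theta> D \<epsilon>J this(1) g1 \<kappa>'(1) this(2), of K m]
            show "\<exists>C. \<forall>z\<in>W. \<exists>P. \<forall>p\<ge>P. \<forall>e\<in>nbrs p z.
                weight g (good K J) J m e \<le> C * ((1 / 2) ^ p) powr s"
              unfolding \<kappa>'(3)[unfolded q_def, symmetric] using dens by meson
          qed
        qed
      next
        case False
        then have fin: "hausdorff_measure 1 K < \<infinity>" by (simp add: top.not_eq_extremum)
        have gd: "\<exists>j\<ge>m. good K J (cell j z)" if "z \<in> W" for z m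
          using dens[OF that] not_porous_infinitely_good[OF \<theta> D \<epsilon>J \<kappa>'(1)] by blast
        have "hausdorff_measure 1 W = 0"
        proof (rule finite_length_good_null[OF K(1,2) fin _ g16])
          show "\<not> K \<subseteq> cube_set Q" if "m0 \<le> fst Q" for Q using esc[OF that] .
          show "\<exists>j\<ge>m. good K J (cell j z)" if "z \<in> W" for z m using gd[OF that] .
        qed
        then show False using W by simp
      qed
    qed
  qed
  show ?thesis using C main by blast
qed

end
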